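(* For $\alpha>0$, $\lambda\in\mathbb{C}$, $t\in(0,\infty)$, the solution (smooth for $t>0$) to the eigenfunction equation for eigenvalue $\lambda$, $D^\alpha f(t)=\lambda f(t)$, is given by $$f_{RL}(t)=\sum_{j=0}^{\lceil\alpha\rceil-1}c_jR_{\alpha,j}(\lambda,t),\qquad f_{C}(t)=\sum_{j=0}^{\lceil\alpha\rceil-1}c_jP_{\alpha,j}(\lambda,t)$$ when $D^\alpha$ is the Riemann-Liouville fractional derivative ${}^{RL}D^\alpha$ and the Caputo fractional derivative ${}^{C}D^\alpha$, respectively. Here the coefficients $c_j\in\mathbb{C}$ specify the initial values of the derivatives of the eigenfunction.
   Context: For $\nu>0$ the Riemann-Liouville fractional integral based at $0$ is $J^\nu[f](t)=\frac{1}{\Gamma(\nu)}\int_0^tf(z)(t-z)^{\nu-1}\,dz$, provided it converges; $J^0$ is the identity. With $\lceil\alpha\rceil$ the ceiling of $\alpha$, and $D^{\lceil\alpha\rceil}$ the ordinary derivative of integer order $\lceil\alpha\rceil$ in $t$, the order-$\alpha$ Riemann-Liouville and Caputo fractional derivatives based at $0$ are ${}^{RL}D^\alpha[f](t)=D^{\lceil\alpha\rceil}J^{\lceil\alpha\rceil-\alpha}[f](t)$ and ${}^{C}D^\alpha[f](t)=J^{\lceil\alpha\rceil-\alpha}[D^{\lceil\alpha\rceil}f](t)$, provided the fractional integral converges. For $\alpha,\beta>0$ and $z\in\mathbb{C}$, the Mittag-Leffler function is $E_{\alpha,\beta}(z)=\sum_{n=0}^\infty\frac{z^n}{\Gamma(\alpha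 n+\beta)}$. For $\lambda\in\mathbb{C}$, $\alpha>0$, $t>0$: $R_{\alpha,v}(\lambda,t)=t^{\alpha-v-1}E_{\alpha,\alpha-v}(\lambda t^\alpha)$ for $v<\alpha$, and $P_{\alpha,w}(\lambda,t)=t^wE_{\alpha,w+1}(\lambda t^\alpha)$ for $w>-1$. *)

theory Defs
  imports "HOL-Analysis.Analysis"
begin

definition nderiv :: "nat \<Rightarrow> (real \<Rightarrow> complex) \<Rightarrow> real \<Rightarrow> complex" where
  "nderiv n f = ((\<lambda>g t. vector_derivative g (at t)) ^^ n) f"

text \<open>The library derivative is total, so the existence of the derivatives is stated separately.\<close>

definition ndifferentiable_on :: "nat \<Rightarrow> (real \<Rightarrow> complex) \<Rightarrow> real set \<Rightarrow> bool" where
  "ndifferentiable_on n f S \<longleftrightarrow> (\<forall>k<n. \<forall>t\<in>S. nderiv k f differentiable (at t))"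

definition smooth_on :: "(real \<Rightarrow> complex) \<Rightarrow> real set \<Rightarrow> bool" where
  "smooth_on f S \<longleftrightarrow> (\<forall>n. ndifferentiable_on n f S)"

text \<open>The fractional integral of order \<open>\<nu> \<ge> 0\<close> based at \<open>0\<close>, as a Lebesgue integral over the open
  interval; the value of \<open>f\<close> at \<open>0\<close> plays no role.\<close>

definition RL_integral :: "real \<Rightarrow> (real \<Rightarrow> complex) \<Rightarrow> real \<Rightarrow> complex" where
  "RL_integral \<nu> f t =
     (if \<nu> = 0 then f t
      else (1 / Gamma \<nu>) *\<^sub>R (LINT z:{0<..<t}|lborel. (t - z) powr (\<nu> - 1) *\<^sub>R f z))"

definition RL_integral_converges :: "real \<Rightarrow> (real \<Rightarrow> complex) \<Rightarrow> real \<Rightarrow> bool" where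
  "RL_integral_converges \<nu> f t \<longleftrightarrow>
     \<nu> = 0 \<or> set_integrable lborel {0<..<t} (\<lambda>z. (t - z) powr (\<nu> - 1) *\<^sub>R f z)"

text \<open>For \<open>-1 < \<alpha> \<le> 0\<close> the ceiling is \<open>0\<close>, and \<open>RL_deriv \<alpha>\<close> is the fractional integral of
  order \<open>-\<alpha>\<close>.\<close>

definition RL_deriv :: "real \<Rightarrow> (real \<Rightarrow> complex) \<Rightarrow> real \<Rightarrow> complex" where
  "RL_deriv \<alpha> f = nderiv (nat \<lceil>\<alpha>\<rceil>) (RL_integral (real_of_int \<lceil>\<alpha>\<rceil> - \<alpha>) f)"

definition Caputo_deriv :: "real \<Rightarrow> (real \<Rightarrow> complex) \<Rightarrow> real \<Rightarrow> complex" where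
  "Caputo_deriv \<alpha> f = RL_integral (real_of_int \<lceil>\<alpha>\<rceil> - \<alpha>) (nderiv (nat \<lceil>\<alpha>\<rceil>) f)"

definition RL_eigenfunction :: "real \<Rightarrow> complex \<Rightarrow> (real \<Rightarrow> complex) \<Rightarrow> bool" where
  "RL_eigenfunction \<alpha> \<mu> f \<longleftrightarrow>
     smooth_on f {0<..} \<and>
     (\<forall>t>0. RL_integral_converges (real_of_int \<lceil>\<alpha>\<rceil> - \<alpha>) f t) \<and>
     ndifferentiable_on (nat \<lceil>\<alpha>\<rceil>) (RL_integral (real_of_int \<lceil>\<alpha>\<rceil> - \<alpha>) f) {0<..} \<and>
     (\<forall>t>0. RL_deriv \<alpha> f t = \<mu> * f t)"

definition Caputo_eigenfunction :: "real \<Rightarrow> complex \<Rightarrow> (real \<Rightarrow> complex) \<Rightarrow> bool" where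
  "Caputo_eigenfunction \<alpha> \<mu> f \<longleftrightarrow>
     smooth_on f {0<..} \<and>
     (\<forall>t>0. RL_integral_converges (real_of_int \<lceil>\<alpha>\<rceil> - \<alpha>) (nderiv (nat \<lceil>\<alpha>\<rceil>) f) t) \<and>
     (\<forall>t>0. Caputo_deriv \<alpha> f t = \<mu> * f t)"

definition Mittag_Leffler :: "real \<Rightarrow> real \<Rightarrow> complex \<Rightarrow> complex" where
  "Mittag_Leffler \<alpha> \<beta> z = (\<Sum>n. z ^ n / of_real (Gamma (\<alpha> * real n + \<beta>)))"

definition R_fun :: "real \<Rightarrow> real \<Rightarrow> complex \<Rightarrow> real \<Rightarrow> complex" where
  "R_fun \<alpha> v \<mu> t =
     of_real (t powr (\<alpha> - v - 1)) * Mittag_Leffler \<alpha> (\<alpha> - v) (\<mu> * of_real (t powr \<alpha>))"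

definition P_fun :: "real \<Rightarrow> real \<Rightarrow> complex \<Rightarrow> real \<Rightarrow> complex" where
  "P_fun \<alpha> w \<mu> t =
     of_real (t powr w) * Mittag_Leffler \<alpha> (w + 1) (\<mu> * of_real (t powr \<alpha>))"

end

theory Submission
  imports Defs
begin

text \<open>With \<open>R_fun \<alpha> v = P_fun \<alpha> (\<alpha> - v - 1)\<close> everything is expressed through the functions
  \<open>P\<^sub>s = P_fun \<alpha> s \<mu>\<close>, \<open>s\<close> real. They satisfy \<open>P\<^sub>s' = P\<^sub>s\<^sub>-\<^sub>1\<close>, \<open>J\<^sup>\<nu> P\<^sub>s = P\<^sub>s\<^sub>+\<^sub>\<nu>\<close> for \<open>s > -1\<close>, and
  \<open>P\<^sub>s = \<mu> P\<^sub>s\<^sub>+\<^sub>\<alpha>\<close> for negative integers \<open>s\<close>, where the leading coefficient \<open>1 / \<Gamma>(s + 1)\<close> vanishes.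
  Hence the stated combinations are eigenfunctions with the stated initial values.

  Conversely, an eigenfunction is integrable at \<open>0\<close>, so the relevant derivatives have limits there.
  Subtracting the combination with the same limits leaves an eigenfunction \<open>h\<close> with zero initial
  values. The semigroup law then gives \<open>H = \<mu> J\<^sup>\<alpha> H\<close> for \<open>H = J\<^sup>1 h\<close> (Riemann-Liouville) or \<open>H = h\<close>
  (Caputo), and iterating this bounds \<open>H\<close> by the terms of a convergent Mittag-Leffler series.\<close>

subsection \<open>The semigroup law for fractional integrals\<close>

text \<open>The substitution \<open>s = z + (t - z) * x\<close> turns this into a Beta integral over
  the unit interval. It serves as the inner integral in the Fubini argument for the semigroup law
  and, with \<open>z = 0\<close>, as the fractional integral of a power.\<close>

lemma Gamma_kernel_has_bochner_integral:
  fixes a b t z :: real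
  assumes a: "a > 0" and b: "b > 0" and zt: "z < t"
  shows "has_bochner_integral lborel
           (\<lambda>s. indicator {z<..<t} s * ((t - s) powr (a - 1) * (s - z) powr (b - 1)))
           (Gamma a * Gamma b / Gamma (a + b) * (t - z) powr (a + b - 1))"
proof -
  define c where "c = t - z"
  have c: "c > 0" using zt by (simp add: c_def)
  \<comment> \<open>A nonnegative integral can be computed before integrability is known; its finite
    value then gives integrability and the Bochner value together.\<close>
  have nn: "(\<integral>\<^sup>+s. ennreal (indicator {z<..<t} s * ((t - s) powr (a - 1) * (s - z) powr (b - 1))) \<partial>lborel)
     = ennreal (Gamma a * Gamma b / Gamma (a + b) * (t - z) powr (a + b - 1))"
  proof -
    have Bpos: "Beta b a > 0"
      using a b by (simp add: Beta_def)
    have I: "((\<lambda>x. x powr (b - 1) * (1 - x) powr (a - 1)) has_integral Beta b a) {0<..<1}"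
      using has_integral_Beta_real[OF b a] by (simp add: has_integral_Icc_iff_Ioo)
    have "(\<integral>\<^sup>+s. ennreal (indicator {z<..<t} s * ((t - s) powr (a - 1) * (s - z) powr (b - 1))) \<partial>lborel)
        = ennreal c * (\<integral>\<^sup>+x. ennreal (indicator {z<..<t} (z + c * x) *
            ((t - (z + c * x)) powr (a - 1) * ((z + c * x) - z) powr (b - 1))) \<partial>lborel)"
      using c by (subst nn_integral_real_affine[of _ c z]) auto
    also have "(\<lambda>x. ennreal (indicator {z<..<t} (z + c * x) *
            ((t - (z + c * x)) powr (a - 1) * ((z + c * x) - z) powr (b - 1))))
        = (\<lambda>x. ennreal (c powr (a + b - 2)) *
            ennreal (indicator {0<..<1} x * (x powr (b - 1) * (1 - x) powr (a - 1))))"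
    proof
      fix x :: real
      have ind: "z + c * x \<in> {z<..<t} \<longleftrightarrow> x \<in> {0<..<1}"
      proof -
        have "z + c * x < t \<longleftrightarrow> c * x < c * 1" by (auto simp: c_def)
        then show ?thesis using mult_less_cancel_left_pos[OF c, of x 1] c
          by (auto simp: zero_less_mult_iff)
      qed
      show "ennreal (indicator {z<..<t} (z + c * x) *
            ((t - (z + c * x)) powr (a - 1) * ((z + c * x) - z) powr (b - 1))) =
          ennreal (c powr (a + b - 2)) *
            ennreal (indicator {0<..<1} x * (x powr (b - 1) * (1 - x) powr (a - 1)))"
      proof (cases "x \<in> {0<..<1}")
        case True
        have "t - (z + c * x) = c * (1 - x)" by (simp add: c_def algebra_simps)
        then have "(t - (z + c * x)) powr (a - 1) * ((z + c * x) - z) powr (b - 1)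
            = (c powr (a - 1) * c powr (b - 1)) * (x powr (b - 1) * (1 - x) powr (a - 1))"
          using True c by (simp add: powr_mult)
        also have "c powr (a - 1) * c powr (b - 1) = c powr (a + b - 2)"
          by (simp flip: powr_add add: algebra_simps)
        finally show ?thesis using True ind by (simp add: ennreal_mult)
      qed (use ind in auto)
    qed
    also have "(\<integral>\<^sup>+x. ennreal (c powr (a + b - 2)) *
            ennreal (indicator {0<..<1} x * (x powr (b - 1) * (1 - x) powr (a - 1))) \<partial>lborel)
       = ennreal (c powr (a + b - 2)) * ennreal (Beta b a)"
      by (subst nn_integral_cmult)
         (use nn_integral_has_integral_lebesgue[OF _ I] in auto)
    also have "ennreal c * (ennreal (c powr (a + b - 2)) * ennreal (Beta b a))
       = ennreal (c * c powr (a + b - 2) * Beta b a)"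
      using c Bpos by (simp add: ennreal_mult mult.assoc)
    also have "c * c powr (a + b - 2) = c powr (a + b - 1)"
      using c powr_add[of c 1 "a + b - 2"] by (simp add: algebra_simps)
    also have "c powr (a + b - 1) * Beta b a = Gamma a * Gamma b / Gamma (a + b) * (t - z) powr (a + b - 1)"
      by (simp add: Beta_def c_def add.commute)
    finally show ?thesis .
  qed
  show ?thesis
    by (rule has_bochner_integral_nn_integral[OF _ _ _ nn]) (use a b in auto)
qed

lemma RL_integral_conv:
  assumes "\<nu> > 0"
  shows "RL_integral \<nu> f t = (1 / Gamma \<nu>) *\<^sub>R (LINT z:{0<..<t}|lborel. (t - z) powr (\<nu> - 1) *\<^sub>R f z)"
  using assms by (simp add: RL_integral_def)

text \<open>The condition \<open>a + b \<ge> 1\<close> keeps the kernel \<open>(t - z) powr (a + b - 1)\<close> bounded, so that the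
  identity holds at every point and not merely almost everywhere.\<close>

lemma RL_integral_semigroup_pos:
  fixes h :: "real \<Rightarrow> complex"
  assumes a: "a > 0" and b: "b > 0" and ab: "a + b \<ge> 1" and t: "t > 0"
    and h: "set_integrable lborel {0<..<t} h"
  shows "RL_integral a (RL_integral b h) t = RL_integral (a + b) h t"
proof -
  define L where "L = (\<lambda>z. indicator {0<..<t} z *\<^sub>R h z)"
  define C where "C = Gamma a * Gamma b / Gamma (a + b)"
  have L[measurable]: "L \<in> borel_measurable lborel" and Lint: "integrable lborel L"
    using h by (auto simp: L_def set_integrable_def)
  \<comment> \<open>\<open>F z s\<close> is the common integrand on the triangle 0 < z < s < t:
    integrating over \<open>s\<close> first produces the kernel of order \<open>a + b\<close>,
    integrating over \<open>z\<close> first produces the nested fractional integrals.\<close>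
  define k where "k = (\<lambda>z s. indicator {z<..<t} s * ((t - s) powr (a - 1) * (s - z) powr (b - 1)))"
  define F where "F = (\<lambda>z s. k z s *\<^sub>R L z)"
  \<comment> \<open>Written as the indicator of a set of pairs, so that joint measurability can be
    derived mechanically.\<close>
  have k_alt: "k z s = indicator {x. fst x < snd x \<and> snd x < t} (z, s) * ((t - s) powr (a - 1) * (s - z) powr (b - 1))" for z s
    by (auto simp: k_def indicator_def)
  have [measurable]: "case_prod k \<in> borel_measurable (lborel \<Otimes>\<^sub>M lborel)"
    unfolding k_alt by measurable
  have F_meas[measurable]: "case_prod F \<in> borel_measurable (lborel \<Otimes>\<^sub>M lborel)"
    unfolding F_def by measurable
  have kint: "has_bochner_integral lborel (k z) (C * (t - z) powr (a + b - 1))" if "z < t" for z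
    unfolding k_def C_def using Gamma_kernel_has_bochner_integral[OF a b that] .
  have knn: "k z s \<ge> 0" for z s by (simp add: k_def)
  have C: "C > 0" unfolding C_def using a b by simp
  have F1: "has_bochner_integral lborel (F z) ((C * (t - z) powr (a + b - 1)) *\<^sub>R L z)" for z
  proof (cases "z < t")
    case True
    show ?thesis unfolding F_def by (intro has_bochner_integral_scaleR_left kint True)
  next
    case False
    then show ?thesis by (simp add: F_def L_def has_bochner_integral_zero)
  qed
  have "integrable (lborel \<Otimes>\<^sub>M lborel) (case_prod F)"
  proof (rule lborel_pair.Fubini_integrable)
    have eq: "(LINT s|lborel. norm (case_prod F (z, s))) = (C * (t - z) powr (a + b - 1)) * norm (L z)" for z
    proof (cases "z < t")
      case True
      have "(LINT s|lborel. norm (case_prod F (z, s))) = (LINT s|lborel. k z s * norm (L z))"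
        using knn by (simp add: F_def)
      also have "\<dots> = (C * (t - z) powr (a + b - 1)) * norm (L z)"
        using kint[OF True] by (simp add: has_bochner_integral_iff)
      finally show ?thesis .
    next
      case False
      then show ?thesis by (simp add: F_def L_def)
    qed
    show "integrable lborel (\<lambda>z. LINT s|lborel. norm (case_prod F (z, s)))"
    proof (rule Bochner_Integration.integrable_bound)
      show "integrable lborel (\<lambda>z. (C * t powr (a + b - 1)) *\<^sub>R L z)" using Lint by simp
      show "AE z in lborel. norm (LINT s|lborel. norm (case_prod F (z, s)))
          \<le> norm ((C * t powr (a + b - 1)) *\<^sub>R L z)"
      proof (intro AE_I2)
        fix z :: real
        show "norm (LINT s|lborel. norm (case_prod F (z, s))) \<le> norm ((C * t powr (a + b - 1)) *\<^sub>R L z)"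
        proof (cases "z \<in> {0<..<t}")
          case True
          then have "(t - z) powr (a + b - 1) \<le> t powr (a + b - 1)"
            using ab by (intro powr_mono2) auto
          then show ?thesis unfolding eq using C by (simp add: mult_right_mono mult_left_mono abs_mult)
        next
          case False
          then show ?thesis unfolding eq by (simp add: L_def)
        qed
      qed
    qed (unfold eq, measurable)
    show "AE z in lborel. integrable lborel (\<lambda>s. case_prod F (z, s))"
      using F1 by (simp add: has_bochner_integral_iff)
  qed measurable
  note Fi = this
  have z_side: "(LINT z|lborel. (LINT s|lborel. F z s)) = (C * Gamma (a + b)) *\<^sub>R RL_integral (a + b) h t"
  proof -
    have "(LINT s|lborel. F z s) = C *\<^sub>R indicator {0<..<t} z *\<^sub>R (t - z) powr (a + b - 1) *\<^sub>R h z" for z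
      using F1[of z] by (simp add: has_bochner_integral_iff L_def)
    then have "(LINT z|lborel. (LINT s|lborel. F z s))
        = C *\<^sub>R (LINT z:{0<..<t}|lborel. (t - z) powr (a + b - 1) *\<^sub>R h z)"
      by (simp only: set_lebesgue_integral_def integral_scaleR_right)
    moreover have "Gamma (a + b) \<noteq> 0" using Gamma_real_pos[of "a + b"] a b by linarith
    ultimately show ?thesis using a b by (simp add: RL_integral_conv)
  qed
  have s_side: "(LINT z|lborel. F z s) = Gamma b *\<^sub>R indicator {0<..<t} s *\<^sub>R (t - s) powr (a - 1) *\<^sub>R RL_integral b h s" for s
  proof (cases "s \<in> {0<..<t}")
    case True
    have "(\<lambda>z. F z s) = (\<lambda>z. (t - s) powr (a - 1) *\<^sub>R (indicator {0<..<s} z *\<^sub>R (s - z) powr (b - 1) *\<^sub>R h z))"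
      using True by (auto simp: fun_eq_iff F_def k_def L_def indicator_def)
    then have "(LINT z|lborel. F z s) = (t - s) powr (a - 1) *\<^sub>R
        (LINT z:{0<..<s}|lborel. (s - z) powr (b - 1) *\<^sub>R h z)"
      by (simp only: set_lebesgue_integral_def integral_scaleR_right)
    moreover have "Gamma b \<noteq> 0" using Gamma_real_pos[OF b] by linarith
    ultimately show ?thesis using True b by (simp add: RL_integral_conv)
  next
    case False
    then have "(\<lambda>z. F z s) = (\<lambda>z. 0)" by (auto simp: fun_eq_iff F_def k_def L_def indicator_def)
    then show ?thesis using False by simp
  qed
  have gb: "Gamma b \<noteq> 0" using Gamma_real_pos[OF b] by linarith
  have "(LINT s|lborel. (LINT z|lborel. F z s)) = (LINT z|lborel. (LINT s|lborel. F z s))"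
    using lborel_pair.Fubini_integral[OF Fi] .
  then have "Gamma b *\<^sub>R (LINT s:{0<..<t}|lborel. (t - s) powr (a - 1) *\<^sub>R RL_integral b h s)
      = (C * Gamma (a + b)) *\<^sub>R RL_integral (a + b) h t"
    unfolding z_side s_side by (simp only: set_lebesgue_integral_def integral_scaleR_right)
  moreover have "Gamma a \<noteq> 0" using Gamma_real_pos[OF a] by linarith
  ultimately have "(Gamma b * Gamma a) *\<^sub>R RL_integral a (RL_integral b h) t
      = (C * Gamma (a + b)) *\<^sub>R RL_integral (a + b) h t"
    using a by (simp add: RL_integral_conv)
  moreover have "Gamma (a + b) \<noteq> 0" using Gamma_real_pos[of "a + b"] a b by linarith
  then have "C * Gamma (a + b) = Gamma b * Gamma a" by (simp add: C_def)
  ultimately show "RL_integral a (RL_integral b h) t = RL_integral (a + b) h t"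
    using gb \<open>Gamma a \<noteq> 0\<close> by simp
qed

subsection \<open>Mittag-Leffler functions\<close>

text \<open>Only the part of the Gamma integral over \<open>t \<ge> K\<close> is kept, where
  \<open>t powr (x - 1)\<close> is at least \<open>K powr (x - 1)\<close>. As \<open>K\<close> is
  arbitrary, Gamma outgrows every geometric sequence, which is what makes the Mittag-Leffler series
  converge.\<close>

lemma Gamma_lower_bound:
  fixes x K :: real
  assumes x: "x \<ge> 1" and K: "K > 0"
  shows "Gamma x \<ge> K powr (x - 1) * exp (- K)"
proof -
  \<comment> \<open>\<open>0 - (- exp (- K))\<close> is the limit at infinity minus the value at
    \<open>K\<close> of the antiderivative \<open>- exp (- t)\<close>, the shape that the
    fundamental theorem on a half-line produces.\<close>
  have "ennreal (K powr (x - 1) * exp (- K)) = ennreal (K powr (x - 1)) * ennreal (0 - (- exp (- K)))"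
    by (simp add: ennreal_mult)
  also have "ennreal (0 - (- exp (- K))) = (\<integral>\<^sup>+t. ennreal (exp (- t)) * indicator {K..} t \<partial>lborel)"
  proof (subst nn_integral_FTC_atLeast[where F = "\<lambda>t. - exp (- t)" and T = 0])
    show "((\<lambda>t::real. - exp (- t)) \<longlongrightarrow> 0) at_top"
      using tendsto_minus[OF filterlim_compose[OF exp_at_bot filterlim_uminus_at_bot_at_top]] by simp
  qed (auto intro!: derivative_eq_intros)
  also have "ennreal (K powr (x - 1)) * (\<integral>\<^sup>+t. ennreal (exp (- t)) * indicator {K..} t \<partial>lborel)
      = (\<integral>\<^sup>+t. ennreal (K powr (x - 1)) * (ennreal (exp (- t)) * indicator {K..} t) \<partial>lborel)"
    by (rule nn_integral_cmult[symmetric]) auto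
  also have "\<dots> \<le> (\<integral>\<^sup>+t. ennreal (indicator {0..} t * t powr (x - 1) / exp t) \<partial>lborel)"
  proof (intro nn_integral_mono)
    fix t :: real
    show "ennreal (K powr (x - 1)) * (ennreal (exp (- t)) * indicator {K..} t)
        \<le> ennreal (indicator {0..} t * t powr (x - 1) / exp t)"
    proof (cases "t \<ge> K")
      case True
      then have "K powr (x - 1) \<le> t powr (x - 1)"
        using x K by (intro powr_mono2) auto
      then have "K powr (x - 1) * exp (- t) \<le> t powr (x - 1) / exp t"
        by (simp add: exp_minus divide_inverse mult_right_mono)
      then show ?thesis using True K by (simp flip: ennreal_mult)
    qed auto
  qed
  also have "\<dots> = ennreal (Gamma x)"
    using Gamma_conv_nn_integral_real[of x] x by simp
  finally show ?thesis using x by simp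
qed

lemma powr_times_nat: "x > 0 \<Longrightarrow> x powr (a * real n) = (x powr a) ^ n" for x a :: real
  by (simp add: powr_powr[symmetric] powr_realpow)

text \<open>Comparison with a geometric series of ratio 1/2. It takes effect only once the Gamma
  argument is at least 1; the finitely many earlier terms may sit at poles of Gamma, where
  \<open>rGamma\<close> is 0.\<close>

lemma summable_rGamma_power:
  fixes \<alpha> s y :: real
  assumes \<alpha>: "\<alpha> > 0"
  shows "summable (\<lambda>n. \<bar>rGamma (\<alpha> * real n + s + 1) * y ^ n\<bar>)"
proof -
  \<comment> \<open>Chosen so that \<open>K powr \<alpha>\<close> equals
    \<open>2 * (\<bar>y\<bar> + 1)\<close>; the lower bound on Gamma then beats \<open>y ^ n\<close>
    by a factor \<open>2 ^ n\<close>.\<close>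
  define K where "K = (2 * (\<bar>y\<bar> + 1)) powr (1 / \<alpha>)"
  have K: "K > 0" by (simp add: K_def)
  have K\<alpha>: "K powr \<alpha> = 2 * (\<bar>y\<bar> + 1)" using \<alpha> by (simp add: K_def powr_powr)
  define D where "D = exp K * K powr (- s)"
  show ?thesis
  proof (rule summable_comparison_test_ev)
    show "summable (\<lambda>n. D * (1 / 2) ^ n :: real)"
      by (intro summable_mult summable_geometric) auto
    have "filterlim (\<lambda>n. \<alpha> * real n) at_top sequentially"
      using \<alpha> by (intro filterlim_tendsto_pos_mult_at_top[OF tendsto_const] filterlim_real_sequentially) auto
    then have "\<forall>\<^sub>F n in sequentially. \<alpha> * real n \<ge> - s"
      unfolding filterlim_at_top by blast
    then show "\<forall>\<^sub>F n in sequentially. norm \<bar>rGamma (\<alpha> * real n + s + 1) * y ^ n\<bar> \<le> D * (1 / 2) ^ n"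
    proof eventually_elim
      case (elim n)
      define x where "x = \<alpha> * real n + s + 1"
      have x: "x \<ge> 1" using elim by (simp add: x_def)
      have "K powr (x - 1) * exp (- K) > 0" using K by simp
      then have "rGamma x \<le> inverse (K powr (x - 1) * exp (- K))"
        unfolding rGamma_inverse_Gamma by (intro le_imp_inverse_le Gamma_lower_bound x K)
      also have "\<dots> = exp K * K powr (- s) * K powr (- (\<alpha> * real n))"
        using K by (simp add: x_def powr_diff powr_add powr_minus exp_minus field_simps)
      also have "K powr (- (\<alpha> * real n)) = inverse ((K powr \<alpha>) ^ n)"
        by (simp add: powr_minus powr_times_nat K)
      finally have r: "rGamma x \<le> D * inverse ((2 * (\<bar>y\<bar> + 1)) ^ n)" by (simp add: D_def K\<alpha>)
      have r0: "rGamma x \<ge> 0" using x by (simp add: rGamma_inverse_Gamma)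
      have "\<bar>rGamma x * y ^ n\<bar> = rGamma x * \<bar>y\<bar> ^ n" using r0 by (simp add: abs_mult power_abs)
      also have "\<dots> \<le> (D * inverse ((2 * (\<bar>y\<bar> + 1)) ^ n)) * (\<bar>y\<bar> + 1) ^ n"
        by (intro mult_mono r power_mono order_trans[OF r0 r]) auto
      also have "\<dots> = D * (1 / 2) ^ n"
        unfolding power_mult_distrib by (simp add: field_simps power_one_over)
      finally show ?case by (simp add: x_def)
    qed
  qed
qed

lemma summable_norm_Mittag_Leffler:
  fixes z :: complex
  assumes "\<alpha> > 0"
  shows "summable (\<lambda>n. norm (of_real (rGamma (\<alpha> * real n + s + 1)) * z ^ n))"
  using summable_rGamma_power[OF assms, of s "norm z"] by (simp add: norm_mult norm_power abs_mult)

text \<open>At a pole Gamma has the default value 0, and division by 0 gives 0, which is the true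
  value of the reciprocal Gamma function there. With \<open>rGamma\<close> the series is meaningful
  for every real \<open>s\<close>.\<close>

lemma Mittag_Leffler_conv:
  "Mittag_Leffler \<alpha> (s + 1) z = (\<Sum>n. of_real (rGamma (\<alpha> * real n + s + 1)) * z ^ n)"
  by (simp add: Mittag_Leffler_def rGamma_inverse_Gamma add.assoc divide_inverse mult.commute)

lemma Mittag_Leffler_sums:
  assumes "\<alpha> > 0"
  shows "(\<lambda>n. of_real (rGamma (\<alpha> * real n + s + 1)) * z ^ n) sums Mittag_Leffler \<alpha> (s + 1) z"
  unfolding Mittag_Leffler_conv
  using summable_norm_cancel[OF summable_norm_Mittag_Leffler[OF assms]] by (rule summable_sums)

lemma R_fun_conv_P_fun: "R_fun \<alpha> v \<mu> t = P_fun \<alpha> (\<alpha> - v - 1) \<mu> t"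
  by (simp add: R_fun_def P_fun_def)

text \<open>Each term is a power of \<open>t\<close> normalised by the Gamma function of its
  exponent plus 1, so differentiation and fractional integration merely shift
  \<open>s\<close>.\<close>

lemma P_fun_sums:
  assumes "\<alpha> > 0" "t > 0"
  shows "(\<lambda>n. \<mu> ^ n * of_real (rGamma (\<alpha> * real n + s + 1) * t powr (\<alpha> * real n + s))) sums P_fun \<alpha> s \<mu> t"
proof -
  have eq: "of_real (t powr s) * (of_real (rGamma (\<alpha> * real n + s + 1)) * (\<mu> * of_real (t powr \<alpha>)) ^ n)
      = \<mu> ^ n * of_real (rGamma (\<alpha> * real n + s + 1) * t powr (\<alpha> * real n + s))" for n
    using assms by (simp add: power_mult_distrib powr_add powr_times_nat)
  then show ?thesis
    using sums_mult[OF Mittag_Leffler_sums[OF assms(1), of s "\<mu> * of_real (t powr \<alpha>)"], of "of_real (t powr s)"]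
    by (simp only: eq P_fun_def)
qed

lemma summable_norm_P_fun:
  fixes \<mu> :: complex
  assumes "\<alpha> > 0" "t > 0"
  shows "summable (\<lambda>n. norm (\<mu> ^ n * of_real (rGamma (\<alpha> * real n + s + 1) * t powr (\<alpha> * real n + s))))"
proof -
  have "norm (\<mu> ^ n * of_real (rGamma (\<alpha> * real n + s + 1) * t powr (\<alpha> * real n + s)))
      = t powr s * norm (of_real (rGamma (\<alpha> * real n + s + 1)) * (\<mu> * of_real (t powr \<alpha>)) ^ n)" for n
    using assms by (simp add: norm_mult norm_power abs_mult power_mult_distrib powr_add powr_times_nat)
  then show ?thesis using summable_mult[OF summable_norm_Mittag_Leffler[OF assms(1)]] by simp
qed

text \<open>The exponents are not integers, so the entire function \<open>E\<close> is
  differentiated instead, with the chain and product rules for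
  \<open>z = \<mu> * of_real (t powr \<alpha>)\<close>. The recurrence of \<open>rGamma\<close>
  recombines the two resulting series, without exceptions at the poles of Gamma.\<close>

lemma P_fun_has_vector_derivative:
  assumes \<alpha>: "\<alpha> > 0" and t: "t > 0"
  shows "(P_fun \<alpha> s \<mu> has_vector_derivative P_fun \<alpha> (s - 1) \<mu> t) (at t)"
proof -
  define c where "c = (\<lambda>n. of_real (rGamma (\<alpha> * real n + s + 1)) :: complex)"
  define E where "E = (\<lambda>z. \<Sum>n. c n * z ^ n)"
  define E' where "E' = (\<lambda>z. \<Sum>n. diffs c n * z ^ n)"
  define z where "z = \<mu> * of_real (t powr \<alpha>)"
  have summ: "summable (\<lambda>n. c n * y ^ n)" for y
    using summable_norm_cancel[OF summable_norm_Mittag_Leffler[OF \<alpha>]] by (simp add: c_def)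
  have E: "(E has_field_derivative E' y) (at y)" for y
    unfolding E_def E'_def by (rule termdiffs_strong_converges_everywhere[OF summ])
  have d1: "((\<lambda>x. \<mu> * of_real (x powr \<alpha>)) has_vector_derivative \<mu> * of_real (\<alpha> * t powr (\<alpha> - 1))) (at t)"
    using t by (auto intro!: derivative_eq_intros has_vector_derivative_of_real simp: has_real_derivative_iff_has_vector_derivative[symmetric])
  have d2: "((\<lambda>x. E (\<mu> * of_real (x powr \<alpha>))) has_vector_derivative \<mu> * of_real (\<alpha> * t powr (\<alpha> - 1)) * E' z) (at t)"
    using field_vector_diff_chain_at[OF d1, of E "E' z"] E by (simp add: o_def z_def)
  have d3: "((\<lambda>x. of_real (x powr s) :: complex) has_vector_derivative of_real (s * t powr (s - 1))) (at t)"
    using t by (auto intro!: derivative_eq_intros has_vector_derivative_of_real simp: has_real_derivative_iff_has_vector_derivative[symmetric])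
  have P: "P_fun \<alpha> s \<mu> = (\<lambda>x. of_real (x powr s) * E (\<mu> * of_real (x powr \<alpha>)))"
    by (simp add: fun_eq_iff P_fun_def Mittag_Leffler_conv E_def c_def)
  \<comment> \<open>In this form of the differentiated series, multiplication by \<open>z\<close>
    restores the power \<open>z ^ n\<close>; at \<open>n = 0\<close> the truncated exponent is
    harmless because the factor \<open>of_nat n\<close> is 0.\<close>
  have "(\<lambda>n. of_nat n * c n * z ^ (n - Suc 0)) sums E' z"
    unfolding E'_def by (intro diffs_equiv termdiff_converges_all summ)
  then have zE': "(\<lambda>n. z * (of_nat n * c n * z ^ (n - Suc 0))) sums (z * E' z)"
    by (rule sums_mult)
  have "(\<lambda>n. of_real s * (c n * z ^ n) + of_real \<alpha> * (z * (of_nat n * c n * z ^ (n - Suc 0))))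
      sums (of_real s * E z + of_real \<alpha> * (z * E' z))"
    unfolding E_def by (intro sums_add sums_mult summable_sums summ zE'[unfolded E_def])
  also have "(\<lambda>n. of_real s * (c n * z ^ n) + of_real \<alpha> * (z * (of_nat n * c n * z ^ (n - Suc 0))))
      = (\<lambda>n. of_real (rGamma (\<alpha> * real n + (s - 1) + 1)) * z ^ n)"
  proof
    fix n
    have "of_real s * (c n * z ^ n) + of_real \<alpha> * (z * (of_nat n * c n * z ^ (n - Suc 0)))
        = of_real ((\<alpha> * real n + s) * rGamma ((\<alpha> * real n + s) + 1)) * z ^ n"
      by (cases n) (simp_all add: c_def algebra_simps)
    also have "(\<alpha> * real n + s) * rGamma ((\<alpha> * real n + s) + 1) = rGamma (\<alpha> * real n + s)"
      by (rule rGamma_plus1)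
    finally show "of_real s * (c n * z ^ n) + of_real \<alpha> * (z * (of_nat n * c n * z ^ (n - Suc 0)))
       = of_real (rGamma (\<alpha> * real n + (s - 1) + 1)) * z ^ n" by simp
  qed
  finally have key: "of_real s * E z + of_real \<alpha> * (z * E' z) = Mittag_Leffler \<alpha> ((s - 1) + 1) z"
    using Mittag_Leffler_sums[OF \<alpha>] sums_unique2 by blast
  have "t powr s = t powr (s - 1) * t" "t powr (\<alpha> - 1) * t = t powr \<alpha>"
    using t by (simp_all add: powr_diff)
  then have "of_real (t powr s) * (\<mu> * of_real (\<alpha> * t powr (\<alpha> - 1)) * E' z)
      = of_real (t powr (s - 1)) * (of_real \<alpha> * (z * E' z))"
    by (simp add: z_def mult_ac) (simp add: mult_ac flip: of_real_mult)
  then have "of_real (t powr s) * (\<mu> * of_real (\<alpha> * t powr (\<alpha> - 1)) * E' z) + of_real (s * t powr (s - 1)) * E z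
      = P_fun \<alpha> (s - 1) \<mu> t"
    unfolding P_fun_def z_def[symmetric] key[symmetric] by (simp add: algebra_simps)
  then show ?thesis
    unfolding P using has_vector_derivative_mult[OF d3 d2] by (simp add: z_def)
qed

text \<open>Dropping the vanishing zeroth term and reindexing extracts one factor
  \<open>\<mu>\<close> and raises every exponent by \<open>\<alpha>\<close>. This is where the
  eigenvalue comes from.\<close>

lemma P_fun_shift:
  assumes "\<alpha> > 0" "t > 0" and s: "s + 1 \<in> \<int>\<^sub>\<le>\<^sub>0"
  shows "P_fun \<alpha> s \<mu> t = \<mu> * P_fun \<alpha> (s + \<alpha>) \<mu> t"
proof -
  let ?g = "\<lambda>n. \<mu> ^ n * of_real (rGamma (\<alpha> * real n + s + 1) * t powr (\<alpha> * real n + s))"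
  have "(\<lambda>n. ?g (Suc n)) sums (P_fun \<alpha> s \<mu> t - ?g 0)"
    using P_fun_sums[OF assms(1,2), of \<mu> s] sums_Suc_iff[of ?g "P_fun \<alpha> s \<mu> t - ?g 0"] by simp
  also have "?g 0 = 0" using s by (simp add: rGamma_eq_zero_iff)
  finally have 1: "(\<lambda>n. ?g (Suc n)) sums P_fun \<alpha> s \<mu> t" by simp
  have "(\<lambda>n. ?g (Suc n)) sums (\<mu> * P_fun \<alpha> (s + \<alpha>) \<mu> t)"
    using sums_mult[OF P_fun_sums[OF assms(1,2), of \<mu> "s + \<alpha>"], of \<mu>]
    by (simp add: algebra_simps)
  with 1 show ?thesis using sums_unique2 by blast
qed

text \<open>The series factor is continuous at 0 with value \<open>rGamma (s + 1)\<close>, so the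
  power \<open>t powr s\<close> decides the limit.\<close>

lemma P_fun_tendsto:
  assumes \<alpha>: "\<alpha> > 0" and "s \<ge> 0"
  shows "(P_fun \<alpha> s \<mu> \<longlongrightarrow> (if s = 0 then 1 else 0)) (at_right 0)"
proof -
  have summ: "summable (\<lambda>n. of_real (rGamma (\<alpha> * real n + s + 1)) * y ^ n)" for y :: complex
    using summable_norm_cancel[OF summable_norm_Mittag_Leffler[OF \<alpha>]] .
  have c: "isCont (Mittag_Leffler \<alpha> (s + 1)) 0"
    using DERIV_isCont[OF termdiffs_strong_converges_everywhere[OF summ]]
    by (simp add: Mittag_Leffler_conv[abs_def])
  have p: "((\<lambda>t::real. t powr r) \<longlongrightarrow> 0) (at_right 0)" if "r > 0" for r
    using that by (intro tendsto_zero_powrI) (auto simp: eventually_at_filter)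
  have "((\<lambda>t. \<mu> * of_real (t powr \<alpha>)) \<longlongrightarrow> \<mu> * of_real 0) (at_right 0)"
    by (intro tendsto_intros p \<alpha>)
  then have "((\<lambda>t. Mittag_Leffler \<alpha> (s + 1) (\<mu> * of_real (t powr \<alpha>))) \<longlongrightarrow> Mittag_Leffler \<alpha> (s + 1) 0) (at_right 0)"
    by (intro isCont_tendsto_compose[OF c]) simp
  then have lim: "((\<lambda>t. Mittag_Leffler \<alpha> (s + 1) (\<mu> * of_real (t powr \<alpha>))) \<longlongrightarrow> of_real (rGamma (s + 1))) (at_right 0)"
    by (simp add: Mittag_Leffler_conv)
  show ?thesis
  proof (cases "s = 0")
    case True
    \<comment> \<open>The identity fails at \<open>t = 0\<close>, since \<open>0 powr 0\<close> is
      0; hence the detour through eventual equality.\<close>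
    have "\<forall>\<^sub>F t in at_right 0. Mittag_Leffler \<alpha> (s + 1) (\<mu> * of_real (t powr \<alpha>)) = P_fun \<alpha> s \<mu> t"
      using eventually_at_right_less[of 0] by eventually_elim (simp add: P_fun_def True)
    with lim show ?thesis using True by (simp add: tendsto_cong)
  next
    case False
    then have "((\<lambda>t. of_real (t powr s) * Mittag_Leffler \<alpha> (s + 1) (\<mu> * of_real (t powr \<alpha>))) \<longlongrightarrow> of_real 0 * of_real (rGamma (s + 1))) (at_right 0)"
      using assms by (intro tendsto_mult lim tendsto_of_real p) auto
    then show ?thesis using False by (simp add: P_fun_def[abs_def])
  qed
qed

text \<open>Termwise integration: the Beta integral raises each exponent by \<open>\<nu>\<close> and
  adjusts its Gamma factor accordingly. The condition \<open>s > -1\<close> makes every term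
  integrable at 0, including the first.\<close>

lemma RL_integral_P_fun:
  assumes \<alpha>: "\<alpha> > 0" and s: "s > -1" and \<nu>: "\<nu> \<ge> 0" and t: "t > 0"
  shows "RL_integral_converges \<nu> (P_fun \<alpha> s \<mu>) t"
    and "RL_integral \<nu> (P_fun \<alpha> s \<mu>) t = P_fun \<alpha> (s + \<nu>) \<mu> t"
proof -
  have "RL_integral_converges \<nu> (P_fun \<alpha> s \<mu>) t \<and> RL_integral \<nu> (P_fun \<alpha> s \<mu>) t = P_fun \<alpha> (s + \<nu>) \<mu> t"
  proof (cases "\<nu> = 0")
    case True
    then show ?thesis by (simp add: RL_integral_converges_def RL_integral_def)
  next
    case False
    then have \<nu>: "\<nu> > 0" using \<nu> by simp
    have g\<nu>: "Gamma \<nu> \<noteq> 0" using Gamma_real_pos[OF \<nu>] by linarith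
    define b where "b = (\<lambda>n. \<alpha> * real n + s + 1)"
    have b: "b n > 0" for n using \<alpha> s by (simp add: b_def add_nonneg_pos add.assoc)
    define k where "k = (\<lambda>n z. indicator {0<..<t} z * ((t - z) powr (\<nu> - 1) * (z - 0) powr (b n - 1)))"
    define w where "w = (\<lambda>n. \<mu> ^ n * of_real (rGamma (b n)) :: complex)"
    define F where "F = (\<lambda>n z. k n z *\<^sub>R w n)"
    define I where "I = (\<lambda>n. Gamma \<nu> * Gamma (b n) / Gamma (\<nu> + b n) * (t - 0) powr (\<nu> + b n - 1))"
    have k: "has_bochner_integral lborel (k n) (I n)" for n
      unfolding k_def I_def by (rule Gamma_kernel_has_bochner_integral[OF \<nu> b t])
    have F: "has_bochner_integral lborel (F n) (I n *\<^sub>R w n)" for n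
      unfolding F_def by (intro has_bochner_integral_scaleR_left k)
    have k0: "k n z \<ge> 0" for n z by (simp add: k_def)
    have nF: "norm (F n z) = k n z * norm (w n)" for n z using k0 by (simp add: F_def)
    \<comment> \<open>The \<open>Gamma (b n)\<close> of the Beta integral cancels
      \<open>rGamma (b n)\<close>, leaving \<open>Gamma \<nu>\<close> times the term of the series
      with exponent \<open>s + \<nu>\<close>.\<close>
    have Iw: "I n *\<^sub>R w n = of_real (Gamma \<nu>) * (\<mu> ^ n * of_real (rGamma (\<alpha> * real n + (s + \<nu>) + 1) * t powr (\<alpha> * real n + (s + \<nu>))))" for n
      using Gamma_real_pos[OF b[of n]] 
      by (simp add: I_def w_def rGamma_inverse_Gamma scaleR_conv_of_real field_simps b_def)
    have Fs: "(\<lambda>n. F n z) sums (indicator {0<..<t} z *\<^sub>R (t - z) powr (\<nu> - 1) *\<^sub>R P_fun \<alpha> s \<mu> z)"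
      and Fn: "summable (\<lambda>n. norm (F n z))" for z
    proof -
      have "(\<lambda>n. F n z) sums (indicator {0<..<t} z *\<^sub>R (t - z) powr (\<nu> - 1) *\<^sub>R P_fun \<alpha> s \<mu> z)
         \<and> summable (\<lambda>n. norm (F n z))"
      proof (cases "z \<in> {0<..<t}")
        case True
        then have z: "z > 0" by simp
        have eq: "F n z = of_real ((t - z) powr (\<nu> - 1)) * (\<mu> ^ n * of_real (rGamma (\<alpha> * real n + s + 1) * z powr (\<alpha> * real n + s)))" for n
          using True by (simp add: F_def k_def w_def b_def scaleR_conv_of_real)
        have "summable (\<lambda>n. norm (of_real ((t - z) powr (\<nu> - 1)) :: complex) * norm (\<mu> ^ n * of_real (rGamma (\<alpha> * real n + s + 1) * z powr (\<alpha> * real n + s))))"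
          by (intro summable_mult summable_norm_P_fun \<alpha> z)
        moreover have "(\<lambda>n. F n z) sums (of_real ((t - z) powr (\<nu> - 1)) * P_fun \<alpha> s \<mu> z)"
          unfolding eq by (intro sums_mult P_fun_sums \<alpha> z)
        ultimately show ?thesis using True by (simp add: eq norm_mult scaleR_conv_of_real)
      next
        case False
        then show ?thesis by (simp add: F_def k_def)
      qed
      then show "(\<lambda>n. F n z) sums (indicator {0<..<t} z *\<^sub>R (t - z) powr (\<nu> - 1) *\<^sub>R P_fun \<alpha> s \<mu> z)"
        "summable (\<lambda>n. norm (F n z))" by auto
    qed
    have Fsum: "(\<Sum>n. F n z) = indicator {0<..<t} z *\<^sub>R (t - z) powr (\<nu> - 1) *\<^sub>R P_fun \<alpha> s \<mu> z" for z
      using Fs sums_unique by metis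
    have Fi: "integrable lborel (F n)" for n using F by (simp add: has_bochner_integral_iff)
    \<comment> \<open>The kernel is nonnegative and \<open>w n\<close> does not depend on
      \<open>z\<close>, so integral and norm commute. Absolute convergence of the target series then
      justifies exchanging sum and integral.\<close>
    have Fnint: "(LINT z|lborel. norm (F n z)) = norm (I n *\<^sub>R w n)" for n
    proof -
      have "I n = (LINT z|lborel. k n z)" using k[of n] by (simp add: has_bochner_integral_iff)
      then have "I n \<ge> 0" using k0 by simp
      then show ?thesis unfolding nF using k[of n] by (simp add: has_bochner_integral_iff)
    qed
    have S: "summable (\<lambda>n. LINT z|lborel. norm (F n z))"
      unfolding Fnint Iw norm_mult[of "of_real (Gamma \<nu>)"]
      by (intro summable_mult summable_norm_P_fun \<alpha> t)
    have conv: "integrable lborel (\<lambda>z. \<Sum>n. F n z)"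
      by (rule integrable_suminf[OF Fi _ S]) (use Fn in auto)
    have "(LINT z|lborel. (\<Sum>n. F n z)) = (\<Sum>n. LINT z|lborel. F n z)"
      by (rule integral_suminf[OF Fi _ S]) (use Fn in auto)
    also have "\<dots> = (\<Sum>n. I n *\<^sub>R w n)" using F by (simp add: has_bochner_integral_iff)
    also have "\<dots> = of_real (Gamma \<nu>) * P_fun \<alpha> (s + \<nu>) \<mu> t"
      unfolding Iw by (intro sums_unique[symmetric] sums_mult P_fun_sums \<alpha> t)
    finally have "(LINT z|lborel. (\<Sum>n. F n z)) = of_real (Gamma \<nu>) * P_fun \<alpha> (s + \<nu>) \<mu> t" .
    then have "RL_integral \<nu> (P_fun \<alpha> s \<mu>) t = P_fun \<alpha> (s + \<nu>) \<mu> t"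
      using \<nu> g\<nu> unfolding Fsum by (simp add: RL_integral_conv set_lebesgue_integral_def scaleR_conv_of_real)
    moreover have "RL_integral_converges \<nu> (P_fun \<alpha> s \<mu>) t"
      using conv unfolding Fsum by (simp add: RL_integral_converges_def set_integrable_def)
    ultimately show ?thesis by blast
  qed
  then show "RL_integral_converges \<nu> (P_fun \<alpha> s \<mu>) t"
    and "RL_integral \<nu> (P_fun \<alpha> s \<mu>) t = P_fun \<alpha> (s + \<nu>) \<mu> t" by auto
qed

subsection \<open>Iterated derivatives and fractional integrals\<close>

lemma nderiv_0 [simp]: "nderiv 0 f = f"
  by (simp add: nderiv_def)

lemma nderiv_Suc: "nderiv (Suc n) f t = vector_derivative (nderiv n f) (at t)"
  by (simp add: nderiv_def)

lemma ndifferentiable_on_has_vector_derivative: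
  assumes "ndifferentiable_on n f S" "k < n" "t \<in> S"
  shows "(nderiv k f has_vector_derivative nderiv (Suc k) f t) (at t)"
  using assms by (simp add: ndifferentiable_on_def nderiv_Suc vector_derivative_works)

lemma ndifferentiable_on_continuous_on:
  assumes "ndifferentiable_on n f S" "k < n"
  shows "continuous_on S (nderiv k f)"
  using assms unfolding ndifferentiable_on_def
  by (meson continuous_at_imp_continuous_on differentiable_imp_continuous_within)

text \<open>Iterated derivatives are computed by guessing the whole chain \<open>F\<close>. Openness
  of \<open>S\<close> lets an identity that holds only on \<open>S\<close> pass to derivatives, and
  existence of the derivatives comes out along with their values.\<close>

lemma nderiv_eqI:
  assumes S: "open S" and F0: "\<And>t. t \<in> S \<Longrightarrow> f t = F 0 t"
    and F: "\<And>k t. k < n \<Longrightarrow> t \<in> S \<Longrightarrow> (F k has_vector_derivative F (Suc k) t) (at t)"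
  shows "ndifferentiable_on n f S" and "k \<le> n \<Longrightarrow> t \<in> S \<Longrightarrow> nderiv k f t = F k t"
proof -
  have step: "(nderiv k f has_vector_derivative F (Suc k) t) (at t)"
    if "\<And>t. t \<in> S \<Longrightarrow> nderiv k f t = F k t" "k < n" "t \<in> S" for k t
    using has_vector_derivative_transform_within_open[OF F[OF that(2,3)] S that(3)] that(1) by simp
  have eq: "k \<le> n \<Longrightarrow> t \<in> S \<Longrightarrow> nderiv k f t = F k t" for k t
  proof (induction k arbitrary: t)
    case (Suc k)
    then show ?case
      using vector_derivative_at[OF step[of k t]] by (simp add: nderiv_Suc)
  qed (simp add: F0)
  show "k \<le> n \<Longrightarrow> t \<in> S \<Longrightarrow> nderiv k f t = F k t" by (rule eq)
  show "ndifferentiable_on n f S"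
    unfolding ndifferentiable_on_def using step eq by (meson differentiableI_vector less_imp_le)
qed

lemma nderiv_diff:
  assumes "open S" "ndifferentiable_on n f S" "ndifferentiable_on n g S"
  shows "ndifferentiable_on n (\<lambda>t. f t - g t) S"
    and "k \<le> n \<Longrightarrow> t \<in> S \<Longrightarrow> nderiv k (\<lambda>t. f t - g t) t = nderiv k f t - nderiv k g t"
  using nderiv_eqI[OF assms(1), of "\<lambda>t. f t - g t" "\<lambda>k t. nderiv k f t - nderiv k g t" n]
    assms(2,3) by (auto intro!: has_vector_derivative_diff ndifferentiable_on_has_vector_derivative)

section \<open>Linearity of the fractional integral and the integral of order one\<close>

lemma RL_integral_0 [simp]: "RL_integral 0 f = f"
  by (simp add: RL_integral_def fun_eq_iff)

lemma RL_integral_cong: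
  assumes "t > 0" "\<And>z. z > 0 \<Longrightarrow> f z = g z"
  shows "RL_integral \<nu> f t = RL_integral \<nu> g t"
    and "RL_integral_converges \<nu> f t = RL_integral_converges \<nu> g t"
proof -
  show "RL_integral \<nu> f t = RL_integral \<nu> g t"
    using assms unfolding RL_integral_def by (auto intro!: set_lebesgue_integral_cong)
  have "set_integrable lborel {0<..<t} (\<lambda>z. (t - z) powr (\<nu> - 1) *\<^sub>R f z)
      = set_integrable lborel {0<..<t} (\<lambda>z. (t - z) powr (\<nu> - 1) *\<^sub>R g z)"
    using assms by (intro set_integrable_cong) auto
  then show "RL_integral_converges \<nu> f t = RL_integral_converges \<nu> g t"
    unfolding RL_integral_converges_def by simp
qed

lemma RL_integral_mult_left: "RL_integral \<nu> (\<lambda>z. c * f z) t = c * RL_integral \<nu> f t"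
  by (simp add: RL_integral_def scaleR_conv_of_real mult.left_commute[of _ c])

lemma RL_integral_diff:
  assumes "RL_integral_converges \<nu> f t" "RL_integral_converges \<nu> g t"
  shows "RL_integral_converges \<nu> (\<lambda>z. f z - g z) t"
    and "RL_integral \<nu> (\<lambda>z. f z - g z) t = RL_integral \<nu> f t - RL_integral \<nu> g t"
  using assms unfolding RL_integral_def RL_integral_converges_def
  by (auto simp: scaleR_diff_right set_integral_diff)

lemma RL_integral_sum:
  assumes "finite A" "\<And>i. i \<in> A \<Longrightarrow> RL_integral_converges \<nu> (f i) t"
  shows "RL_integral_converges \<nu> (\<lambda>z. \<Sum>i\<in>A. c i * f i z) t
    \<and> RL_integral \<nu> (\<lambda>z. \<Sum>i\<in>A. c i * f i z) t = (\<Sum>i\<in>A. c i * RL_integral \<nu> (f i) t)"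
proof (cases "\<nu> = 0")
  case False
  define F where "F = (\<lambda>i z. indicator {0<..<t} z *\<^sub>R (t - z) powr (\<nu> - 1) *\<^sub>R f i z)"
  have int: "integrable lborel (F i)" if "i \<in> A" for i
    using assms(2)[OF that] False by (simp add: F_def RL_integral_converges_def set_integrable_def)
  have eq: "(\<lambda>z. indicator {0<..<t} z *\<^sub>R (t - z) powr (\<nu> - 1) *\<^sub>R (\<Sum>i\<in>A. c i * f i z))
     = (\<lambda>z. \<Sum>i\<in>A. c i * F i z)"
    by (simp add: F_def scaleR_conv_of_real sum_distrib_left mult.left_commute)
  have "RL_integral \<nu> (f i) t = (1 / Gamma \<nu>) *\<^sub>R (LINT z|lborel. F i z)" for i
    using False by (simp add: RL_integral_def set_lebesgue_integral_def F_def)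
  moreover have "RL_integral \<nu> (\<lambda>z. \<Sum>i\<in>A. c i * f i z) t
      = (1 / Gamma \<nu>) *\<^sub>R (LINT z|lborel. (\<Sum>i\<in>A. c i * F i z))"
    using False unfolding RL_integral_def set_lebesgue_integral_def eq by simp
  moreover have "RL_integral_converges \<nu> (\<lambda>z. \<Sum>i\<in>A. c i * f i z) t"
    using int unfolding RL_integral_converges_def set_integrable_def eq by simp
  ultimately show ?thesis
    using int by (simp add: Bochner_Integration.integral_sum scaleR_sum_right)
qed (simp add: RL_integral_converges_def)

text \<open>Order 0 is the identity by a separate clause of the definition, so it is adjoined here;
  it occurs when \<open>\<alpha>\<close> is an integer.\<close>

lemma RL_integral_semigroup:
  fixes h :: "real \<Rightarrow> complex"
  assumes a: "a \<ge> 0" and b: "b \<ge> 0" and ab: "a + b \<ge> 1" and t: "t > 0"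
    and h: "set_integrable lborel {0<..<t} h"
  shows "RL_integral a (RL_integral b h) t = RL_integral (a + b) h t"
  using RL_integral_semigroup_pos[OF _ _ ab t h] a b by (cases "a = 0"; cases "b = 0") auto

lemma RL_integral_1: "RL_integral 1 w t = (LINT z:{0<..<t}|lborel. w z)"
  by (auto simp: RL_integral_def intro!: set_lebesgue_integral_cong)

text \<open>The function \<open>w\<close> may be unbounded near 0. Its integral is rewritten as a
  gauge integral over a closed interval, for which the fundamental theorem holds at points of
  continuity and the indefinite integral is continuous up to 0.\<close>

lemma
  fixes w :: "real \<Rightarrow> complex"
  assumes w: "continuous_on {0<..} w" and int: "\<And>t. t > 0 \<Longrightarrow> set_integrable lborel {0<..<t} w"
  shows RL_integral_1_has_vector_derivative:
      "t > 0 \<Longrightarrow> (RL_integral 1 w has_vector_derivative w t) (at t)"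
    and RL_integral_1_tendsto: "(RL_integral 1 w \<longlongrightarrow> 0) (at_right 0)"
proof -
  have hk: "w integrable_on {0..x}" "RL_integral 1 w x = integral {0..x} w" if "x > 0" for x
    using set_borel_integral_eq_integral[OF int[OF that]]
    by (auto simp: RL_integral_1 integrable_on_def has_integral_Icc_iff_Ioo integral_def)
  show "(RL_integral 1 w has_vector_derivative w t) (at t)" if t: "t > 0"
  proof -
    have "isCont w t" using w t by (simp add: continuous_on_eq_continuous_at)
    \<comment> \<open>The interval extends to \<open>t + 1\<close> so that \<open>t\<close> is
      interior and the one-sided restriction disappears; the removed set is the exceptional set of
      the rule, here empty.\<close>
    then have "((\<lambda>u. integral {0..u} w) has_vector_derivative w t) (at t within {0..t + 1} - {})"
      using t by (intro integral_has_vector_derivative_continuous_at hk)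
        (auto intro: continuous_at_imp_continuous_at_within)
    then have "((\<lambda>u. integral {0..u} w) has_vector_derivative w t) (at t)"
      using t by (simp add: at_within_Icc_at)
    then show ?thesis
      by (rule has_vector_derivative_transform_within_open[of _ _ _ "{0<..}"]) (use t hk in auto)
  qed
  have "continuous_on {0..1} (\<lambda>u. integral {0..u} w)"
    by (intro indefinite_integral_continuous_1 hk) simp
  then have "((\<lambda>u. integral {0..u} w) \<longlongrightarrow> integral {0..0} w) (at 0 within {0..1})"
    unfolding continuous_on_def by (rule bspec) simp
  then have "((\<lambda>u. integral {0..u} w) \<longlongrightarrow> 0) (at_right 0)"
    by (simp add: at_within_Icc_at_right)
  moreover have "\<forall>\<^sub>F x in at_right 0. integral {0..x} w = RL_integral 1 w x"
    using hk by (auto simp: eventually_at_filter)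
  ultimately show "(RL_integral 1 w \<longlongrightarrow> 0) (at_right 0)"
    by (rule Lim_transform_eventually)
qed

text \<open>An integrable derivative forces a limit at 0: \<open>g\<close> minus the integral of
  \<open>w\<close> has derivative 0, hence is constant, and the integral tends to 0.\<close>

lemma antiderivative_eq_RL_integral_1:
  fixes g w :: "real \<Rightarrow> complex"
  assumes w: "continuous_on {0<..} w" and int: "\<And>t. t > 0 \<Longrightarrow> set_integrable lborel {0<..<t} w"
    and g: "\<And>t. t > 0 \<Longrightarrow> (g has_vector_derivative w t) (at t)"
  obtains c where "(g \<longlongrightarrow> c) (at_right 0)" "\<And>t. t > 0 \<Longrightarrow> g t = c + RL_integral 1 w t"
proof -
  have "((\<lambda>t. g t - RL_integral 1 w t) has_vector_derivative 0) (at t within {0<..})" if "t > 0" for t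
    using has_vector_derivative_diff[OF g RL_integral_1_has_vector_derivative[OF w int], OF that _ that] 
    by (auto intro: has_vector_derivative_at_within)
  then obtain c where c: "\<And>t. t > 0 \<Longrightarrow> g t - RL_integral 1 w t = c"
    using has_vector_derivative_zero_constant[of "{0<..}" "\<lambda>t. g t - RL_integral 1 w t"] by auto
  then have eq: "g t = c + RL_integral 1 w t" if "t > 0" for t
    using that by (metis diff_eq_eq)
  have "((\<lambda>t. c + RL_integral 1 w t) \<longlongrightarrow> c + 0) (at_right 0)"
    by (intro tendsto_intros RL_integral_1_tendsto w int)
  moreover have "\<forall>\<^sub>F t in at_right 0. c + RL_integral 1 w t = g t"
    using eq by (auto simp: eventually_at_filter)
  ultimately have "(g \<longlongrightarrow> c) (at_right 0)"
    using Lim_transform_eventually by fastforce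
  with eq that show ?thesis by blast
qed

section \<open>Boundedness, integrability and initial values at the origin\<close>

lemma set_integrable_bounded_continuous:
  fixes g :: "real \<Rightarrow> complex"
  assumes g: "continuous_on {0<..} g" and B: "\<And>z. 0 < z \<Longrightarrow> z < t \<Longrightarrow> norm (g z) \<le> B"
  shows "set_integrable lborel {0<..<t} g"
proof -
  have "continuous_on {0<..<t} g" by (rule continuous_on_subset[OF g]) auto
  then have m: "(\<lambda>z. indicator {0<..<t} z *\<^sub>R g z) \<in> borel_measurable lborel"
    using borel_measurable_continuous_on_indicator[of "{0<..<t}" g] by simp
  have "emeasure lborel {0<..<t} < \<infinity>" by (cases "0 \<le> t") auto
  then have "set_integrable lborel {0<..<t} (\<lambda>_. B)"
    by (simp add: set_integrable_def)
  then show ?thesis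
    unfolding set_integrable_def
  proof (rule Bochner_Integration.integrable_bound)
    have "norm (g z) \<le> norm B" if "0 < z" "z < t" for z
      using B[OF that] by simp
    then show "AE z in lborel. norm (indicator {0<..<t} z *\<^sub>R g z) \<le> norm (indicator {0<..<t} z *\<^sub>R B)"
      by (intro AE_I2) (simp split: split_indicator)
  qed (use m in auto)
qed

text \<open>The limit controls \<open>g\<close> near 0, and compactness controls it on the rest of
  the interval.\<close>

lemma bounded_continuous_tendsto_at_right:
  fixes g :: "real \<Rightarrow> complex"
  assumes g: "continuous_on {0<..} g" and l: "(g \<longlongrightarrow> l) (at_right 0)"
  obtains B where "\<And>z. 0 < z \<Longrightarrow> z \<le> t \<Longrightarrow> norm (g z) \<le> B"
proof -
  have "\<forall>\<^sub>F x in at_right 0. norm (g x) < norm l + 1"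
    by (rule order_tendstoD(2)[OF tendsto_norm[OF l]]) simp
  then obtain d where d: "d > 0" "\<And>x. 0 < x \<Longrightarrow> x < d \<Longrightarrow> norm (g x) < norm l + 1"
    by (auto simp: eventually_at_right_field)
  have "compact (g ` {d..t})"
    using d by (intro compact_continuous_image continuous_on_subset[OF g]) auto
  then obtain B where B: "\<And>x. x \<in> {d..t} \<Longrightarrow> norm (g x) \<le> B"
    using compact_imp_bounded bounded_iff by (metis imageI)
  show ?thesis
  proof (rule that[of "max (norm l + 1) B"])
    fix z assume "0 < z" "z \<le> t"
    then show "norm (g z) \<le> max (norm l + 1) B"
      using d(2)[of z] B[of z] by (cases "z < d") (auto simp: le_max_iff_disj)
  qed
qed

text \<open>Since \<open>\<nu> < 1\<close>, the kernel is at least \<open>t powr (\<nu> - 1)\<close>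
  on the interval, so convergence of the fractional integral bounds the integral of the norm of
  \<open>h\<close>.\<close>

lemma set_integrable_of_RL_integral_converges:
  fixes h :: "real \<Rightarrow> complex"
  assumes \<nu>: "0 < \<nu>" "\<nu> < 1" and h: "continuous_on {0<..} h" and conv: "RL_integral_converges \<nu> h t"
  shows "set_integrable lborel {0<..<t} h"
proof -
  have "continuous_on {0<..<t} h" by (rule continuous_on_subset[OF h]) auto
  then have m: "(\<lambda>z. indicator {0<..<t} z *\<^sub>R h z) \<in> borel_measurable lborel"
    using borel_measurable_continuous_on_indicator[of "{0<..<t}" h] by simp
  have "integrable lborel (\<lambda>z. t powr (1 - \<nu>) *\<^sub>R (indicator {0<..<t} z *\<^sub>R (t - z) powr (\<nu> - 1) *\<^sub>R h z))"
    using conv \<nu> unfolding RL_integral_converges_def set_integrable_def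
    by (intro integrable_scaleR_right) auto
  then show ?thesis
    unfolding set_integrable_def
  proof (rule Bochner_Integration.integrable_bound)
    show "AE z in lborel. norm (indicator {0<..<t} z *\<^sub>R h z)
       \<le> norm (t powr (1 - \<nu>) *\<^sub>R (indicator {0<..<t} z *\<^sub>R (t - z) powr (\<nu> - 1) *\<^sub>R h z))"
    proof (intro AE_I2)
      fix z :: real
      have "norm (h z) \<le> t powr (1 - \<nu>) * ((t - z) powr (\<nu> - 1) * norm (h z))" if z: "0 < z" "z < t"
      proof -
        have "(t - z) powr (1 - \<nu>) \<le> t powr (1 - \<nu>)" using z \<nu> by (intro powr_mono2) auto
        then have "(t - z) powr (1 - \<nu>) * (t - z) powr (\<nu> - 1) \<le> t powr (1 - \<nu>) * (t - z) powr (\<nu> - 1)"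
          by (intro mult_right_mono) auto
        moreover have "(t - z) powr (1 - \<nu>) * (t - z) powr (\<nu> - 1) = 1"
          using z by (simp flip: powr_add)
        ultimately show ?thesis
          using mult_right_mono[of 1 "t powr (1 - \<nu>) * (t - z) powr (\<nu> - 1)" "norm (h z)"]
          by (simp add: mult_ac)
      qed
      then show "norm (indicator {0<..<t} z *\<^sub>R h z)
       \<le> norm (t powr (1 - \<nu>) *\<^sub>R (indicator {0<..<t} z *\<^sub>R (t - z) powr (\<nu> - 1) *\<^sub>R h z))"
        by (auto split: split_indicator)
    qed
  qed (use m in auto)
qed

text \<open>Descending from order \<open>m\<close>: an integrable derivative gives its
  antiderivative a limit at 0, which makes the antiderivative bounded near 0 and hence integrable in
  turn.\<close>

lemma nderiv_tendsto_ex: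
  assumes u: "ndifferentiable_on m u {0<..}" and w: "continuous_on {0<..} (nderiv m u)"
    and int: "\<And>t. t > 0 \<Longrightarrow> set_integrable lborel {0<..<t} (nderiv m u)"
    and k: "k < m"
  shows "\<exists>c. (nderiv k u \<longlongrightarrow> c) (at_right 0)"
proof -
  have "(\<exists>c. (nderiv k u \<longlongrightarrow> c) (at_right 0)) \<and>
        (\<forall>t>0. set_integrable lborel {0<..<t} (nderiv k u))"
    if c1: "continuous_on {0<..} (nderiv (Suc k) u)"
      and i1: "\<forall>t>0. set_integrable lborel {0<..<t} (nderiv (Suc k) u)" and "k < m" for k
  proof -
    have d: "(nderiv k u has_vector_derivative nderiv (Suc k) u t) (at t)" if "t > 0" for t
      using ndifferentiable_on_has_vector_derivative[OF u] \<open>k < m\<close> that by simp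
    obtain c where c: "(nderiv k u \<longlongrightarrow> c) (at_right 0)"
      using antiderivative_eq_RL_integral_1[OF c1 _ d] i1 by blast
    have cont: "continuous_on {0<..} (nderiv k u)"
      using ndifferentiable_on_continuous_on[OF u \<open>k < m\<close>] .
    have "set_integrable lborel {0<..<t} (nderiv k u)" for t
      using bounded_continuous_tendsto_at_right[OF cont c, of t] set_integrable_bounded_continuous[OF cont]
      by (metis less_imp_le)
    with c show ?thesis by blast
  qed
  note down = this
  have cont: "continuous_on {0<..} (nderiv k u)" if "k \<le> m" for k
    using that w ndifferentiable_on_continuous_on[OF u] by (cases "k = m") auto
  have "\<forall>t>0. set_integrable lborel {0<..<t} (nderiv (Suc k) u)"
    using Suc_leI[OF k]
  proof (induction rule: inc_induct)
    case (step n)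
    then show ?case using down[of n] cont[of "Suc n"] by simp
  qed (use int in blast)
  then show ?thesis using down[of k] cont[of "Suc k"] k by simp
qed

text \<open>The Taylor formula at 0 with vanishing initial values: each integration from 0 has
  constant 0, and the semigroup law merges the \<open>m\<close> integrations into one of order
  \<open>m\<close>.\<close>

lemma eq_RL_integral_nderiv:
  assumes u: "ndifferentiable_on m u {0<..}" and w: "continuous_on {0<..} (nderiv m u)"
    and int: "\<And>t. t > 0 \<Longrightarrow> set_integrable lborel {0<..<t} (nderiv m u)"
    and lim: "\<And>k. k < m \<Longrightarrow> (nderiv k u \<longlongrightarrow> 0) (at_right 0)" and t: "t > 0"
  shows "u t = RL_integral (real m) (nderiv m u) t"
proof -
  have "d \<le> m \<Longrightarrow> t > 0 \<Longrightarrow> nderiv (m - d) u t = RL_integral (real d) (nderiv m u) t" for d t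
  proof (induction d arbitrary: t)
    case (Suc d)
    define k where "k = m - Suc d"
    have k: "k < m" "Suc k = m - d" using Suc.prems by (auto simp: k_def)
    have cont: "continuous_on {0<..} (nderiv (Suc k) u)"
      using k w ndifferentiable_on_continuous_on[OF u] by (cases "Suc k = m") auto
    \<comment> \<open>The top derivative is integrable by assumption; the lower ones are bounded
      near 0 because they tend to 0 there.\<close>
    have intk: "set_integrable lborel {0<..<t} (nderiv (Suc k) u)" for t
    proof (cases "Suc k = m")
      case True
      then show ?thesis using int[of t] by (cases "t > 0") (auto simp: set_integrable_def)
    next
      case False
      then have "(nderiv (Suc k) u \<longlongrightarrow> 0) (at_right 0)" using lim k by simp
      from bounded_continuous_tendsto_at_right[OF cont this, of t] 
      show ?thesis using set_integrable_bounded_continuous[OF cont] by (metis less_imp_le)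
    qed
    obtain c where c: "(nderiv k u \<longlongrightarrow> c) (at_right 0)"
      "\<And>t. t > 0 \<Longrightarrow> nderiv k u t = c + RL_integral 1 (nderiv (Suc k) u) t"
      using antiderivative_eq_RL_integral_1[OF cont intk ndifferentiable_on_has_vector_derivative[OF u]] k
      by auto
    have "c = 0" using tendsto_unique[OF _ c(1) lim[OF k(1)]] by simp
    then have "nderiv k u t = RL_integral 1 (nderiv (m - d) u) t" using c(2) Suc.prems k by simp
    also have "\<dots> = RL_integral 1 (RL_integral (real d) (nderiv m u)) t"
      using Suc by (intro RL_integral_cong) auto
    also have "\<dots> = RL_integral (1 + real d) (nderiv m u) t"
      using Suc.prems by (intro RL_integral_semigroup int) auto
    finally show ?case by (simp add: k_def)
  qed simp
  from this[of m t] t show ?thesis by simp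
qed

subsection \<open>Uniqueness\<close>

text \<open>Substituting the equation into itself \<open>n\<close> times bounds \<open>H\<close> by
  \<open>M\<close> times the norm of the \<open>n\<close>-th term of the convergent series for
  \<open>P_fun \<alpha> 0 \<mu>\<close>, and these terms tend to 0.\<close>

lemma Volterra_eq_zero:
  fixes H :: "real \<Rightarrow> complex"
  assumes \<alpha>: "\<alpha> > 0" and bnd: "\<And>t. 0 < t \<Longrightarrow> t \<le> T \<Longrightarrow> norm (H t) \<le> M"
    and H: "\<And>t. t > 0 \<Longrightarrow> H t = \<mu> * RL_integral \<alpha> H t" and T: "T > 0"
  shows "H T = 0"
proof -
  have M: "M \<ge> 0" using bnd[of T] T norm_ge_zero order_trans by (meson order_refl)
  have bound: "norm (H t) \<le> M * (norm \<mu> ^ n * (rGamma (\<alpha> * real n + 1) * t powr (\<alpha> * real n)))"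
    if "0 < t" "t \<le> T" for t n
    using that
  proof (induction n arbitrary: t)
    case 0
    then show ?case using bnd by (simp add: rGamma_inverse_Gamma)
  next
    case (Suc n)
    define b where "b = \<alpha> * real n + 1"
    have b: "b > 0" using \<alpha> by (simp add: b_def add_nonneg_pos)
    define k where "k = (\<lambda>z. indicator {0<..<t} z * ((t - z) powr (\<alpha> - 1) * (z - 0) powr (b - 1)))"
    have k: "has_bochner_integral lborel k (Gamma \<alpha> * Gamma b / Gamma (\<alpha> + b) * (t - 0) powr (\<alpha> + b - 1))"
      unfolding k_def by (rule Gamma_kernel_has_bochner_integral[OF \<alpha> b Suc.prems(1)])
    define D where "D = M * (norm \<mu> ^ n * rGamma b)"
    have D: "D \<ge> 0" using M b by (simp add: D_def rGamma_inverse_Gamma)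
    have g: "Gamma \<alpha> > 0" "Gamma b > 0" using \<alpha> b by auto
    then have g': "Gamma \<alpha> \<noteq> 0" "Gamma b \<noteq> 0" by linarith+
    have "norm (LINT z:{0<..<t}|lborel. (t - z) powr (\<alpha> - 1) *\<^sub>R H z)
       \<le> (LINT z|lborel. norm (indicator {0<..<t} z *\<^sub>R (t - z) powr (\<alpha> - 1) *\<^sub>R H z))"
      unfolding set_lebesgue_integral_def by (rule integral_norm_bound)
    \<comment> \<open>Only the majorant has to be integrable, because a non-integrable function has
      integral 0 by default; pointwise bounds on \<open>H\<close> therefore suffice.\<close>
    also have "\<dots> \<le> (LINT z|lborel. D * k z)"
    proof (rule integral_mono')
      show "integrable lborel (\<lambda>z. D * k z)" using k by (simp add: has_bochner_integral_iff)
      fix z :: real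
      show "0 \<le> D * k z" using D by (simp add: k_def)
      show "norm (indicator {0<..<t} z *\<^sub>R (t - z) powr (\<alpha> - 1) *\<^sub>R H z) \<le> D * k z"
      proof (cases "z \<in> {0<..<t}")
        case True
        then have "norm (H z) \<le> D * z powr (b - 1)" 
          using Suc.IH[of z] Suc.prems by (simp add: D_def b_def mult_ac)
        then have "(t - z) powr (\<alpha> - 1) * norm (H z) \<le> (t - z) powr (\<alpha> - 1) * (D * z powr (b - 1))"
          by (rule mult_left_mono) simp
        then show ?thesis using True by (simp add: k_def mult_ac)
      qed (simp add: k_def)
    qed
    also have "\<dots> = D * (Gamma \<alpha> * Gamma b / Gamma (\<alpha> + b) * t powr (\<alpha> + b - 1))"
      using k by (simp add: has_bochner_integral_iff)
    finally have "norm (RL_integral \<alpha> H t) \<le> (1 / Gamma \<alpha>) * (D * (Gamma \<alpha> * Gamma b / Gamma (\<alpha> + b) * t powr (\<alpha> + b - 1)))"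
      using \<alpha> g g' by (simp add: RL_integral_conv field_simps)
    also have "\<dots> = M * (norm \<mu> ^ n * (rGamma (\<alpha> * real (Suc n) + 1) * t powr (\<alpha> * real (Suc n))))"
      using g' by (simp add: D_def b_def rGamma_inverse_Gamma field_simps)
    finally have "norm \<mu> * norm (RL_integral \<alpha> H t)
        \<le> norm \<mu> * (M * (norm \<mu> ^ n * (rGamma (\<alpha> * real (Suc n) + 1) * t powr (\<alpha> * real (Suc n)))))"
      by (rule mult_left_mono) simp
    then show ?case using H[OF Suc.prems(1)] by (simp add: norm_mult mult_ac)
  qed
  have "(\<lambda>n. norm (\<mu> ^ n * of_real (rGamma (\<alpha> * real n + 0 + 1) * T powr (\<alpha> * real n + 0)))) \<longlonglongrightarrow> 0"
    by (intro summable_LIMSEQ_zero summable_norm_P_fun \<alpha> T)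
  then have "(\<lambda>n. norm \<mu> ^ n * (rGamma (\<alpha> * real n + 1) * T powr (\<alpha> * real n))) \<longlonglongrightarrow> 0"
  proof (rule Lim_transform_eventually, intro always_eventually allI)
    fix n
    have "rGamma (\<alpha> * real n + 1) \<ge> 0"
      using \<alpha> by (auto simp: rGamma_inverse_Gamma intro!: Gamma_real_nonneg add_nonneg_pos)
    then show "norm (\<mu> ^ n * of_real (rGamma (\<alpha> * real n + 0 + 1) * T powr (\<alpha> * real n + 0)))
      = norm \<mu> ^ n * (rGamma (\<alpha> * real n + 1) * T powr (\<alpha> * real n))"
      by (simp add: norm_mult norm_power abs_mult)
  qed
  then have "(\<lambda>n. M * (norm \<mu> ^ n * (rGamma (\<alpha> * real n + 1) * T powr (\<alpha> * real n)))) \<longlonglongrightarrow> M * 0"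
    by (rule tendsto_mult_left)
  then have "norm (H T) \<le> M * 0"
    using bound[of T] T by (intro LIMSEQ_le_const) auto
  then show ?thesis by simp
qed

text \<open>For integer \<open>\<alpha>\<close> the convergence of the fractional integral is vacuous, so integrability at \<open>0\<close>
  has to come from the equation itself: \<open>exp (C * t)\<close> times the sum of the squared norms of the
  derivatives is nondecreasing.\<close>

lemma ODE_eigenfunction_bounded:
  assumes m: "m > 0" and f: "ndifferentiable_on m f {0<..}"
    and eq: "\<And>t. t > 0 \<Longrightarrow> nderiv m f t = \<mu> * f t"
  obtains B where "\<And>t. 0 < t \<Longrightarrow> t \<le> T \<Longrightarrow> norm (f t) \<le> B"
proof -
  define N where "N = (\<lambda>t. \<Sum>k<m. nderiv k f t \<bullet> nderiv k f t)"
  define N' where "N' = (\<lambda>t. \<Sum>k<m. 2 * (nderiv k f t \<bullet> nderiv (Suc k) f t))"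
  \<comment> \<open>By \<open>2 * (x \<bullet> y) \<ge> - (x \<bullet> x) - y \<bullet> y\<close>,
    the derivative of \<open>N\<close> loses at most \<open>N\<close> for the orders below
    \<open>m\<close>, and at most \<open>N\<close> plus the square at order \<open>m\<close> for the
    shifted ones; the equation bounds that square by
    \<open>(norm \<mu>)\<^sup>2 * N\<close>.\<close>
  define C where "C = 2 + (norm \<mu>)\<^sup>2"
  have d: "(N has_real_derivative N' t) (at t)" if "t > 0" for t
  proof -
    have "((\<lambda>t. nderiv k f t \<bullet> nderiv k f t) has_real_derivative 2 * (nderiv k f t \<bullet> nderiv (Suc k) f t)) (at t)"
      if "k < m" for k
    proof -
      have "(nderiv k f has_vector_derivative nderiv (Suc k) f t) (at t)"
        using ndifferentiable_on_has_vector_derivative[OF f that] \<open>t > 0\<close> by simp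
      from has_derivative_inner[OF this[unfolded has_vector_derivative_def] this[unfolded has_vector_derivative_def]]
      have "((\<lambda>t. nderiv k f t \<bullet> nderiv k f t) has_derivative
          (\<lambda>h. nderiv k f t \<bullet> (h *\<^sub>R nderiv (Suc k) f t) + (h *\<^sub>R nderiv (Suc k) f t) \<bullet> nderiv k f t)) (at t)" .
      also have "(\<lambda>h. nderiv k f t \<bullet> (h *\<^sub>R nderiv (Suc k) f t) + (h *\<^sub>R nderiv (Suc k) f t) \<bullet> nderiv k f t)
          = (*) (2 * (nderiv k f t \<bullet> nderiv (Suc k) f t))"
        by (simp add: fun_eq_iff inner_commute)
      finally show ?thesis unfolding has_field_derivative_def .
    qed
    then show ?thesis unfolding N_def N'_def by (intro DERIV_sum) auto
  qed
  have first: "(norm (f t))\<^sup>2 \<le> N t" for t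
  proof -
    have "nderiv 0 f t \<bullet> nderiv 0 f t \<le> N t"
      unfolding N_def using m by (intro member_le_sum) auto
    then show ?thesis by (simp add: dot_square_norm)
  qed
  have N': "C * N t + N' t \<ge> 0" if "t > 0" for t
  proof -
    let ?y = "\<lambda>k. nderiv k f t"
    have "2 * (?y k \<bullet> ?y (Suc k)) \<ge> - (?y k \<bullet> ?y k) - ?y (Suc k) \<bullet> ?y (Suc k)" for k
      using inner_ge_zero[of "?y k + ?y (Suc k)"] by (simp add: inner_simps inner_commute)
    then have "N' t \<ge> (\<Sum>k<m. - (?y k \<bullet> ?y k) - ?y (Suc k) \<bullet> ?y (Suc k))"
      unfolding N'_def by (intro sum_mono)
    also have "(\<Sum>k<m. - (?y k \<bullet> ?y k) - ?y (Suc k) \<bullet> ?y (Suc k))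
        = - N t - (\<Sum>k<m. ?y (Suc k) \<bullet> ?y (Suc k))"
      by (simp add: sum_subtractf sum_negf N_def)
    finally have 1: "N' t \<ge> - N t - (\<Sum>k<m. ?y (Suc k) \<bullet> ?y (Suc k))" .
    have "?y 0 \<bullet> ?y 0 + (\<Sum>k<m. ?y (Suc k) \<bullet> ?y (Suc k)) = (\<Sum>k<Suc m. ?y k \<bullet> ?y k)"
      by (rule sum.lessThan_Suc_shift[symmetric])
    also have "\<dots> = N t + ?y m \<bullet> ?y m" by (simp add: N_def)
    finally have 2: "(\<Sum>k<m. ?y (Suc k) \<bullet> ?y (Suc k)) \<le> N t + ?y m \<bullet> ?y m"
      using inner_ge_zero[of "?y 0"] by linarith
    have "?y m \<bullet> ?y m = (norm \<mu>)\<^sup>2 * (norm (f t))\<^sup>2"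
      using eq[OF that] by (simp add: dot_square_norm norm_mult power_mult_distrib)
    also have "\<dots> \<le> (norm \<mu>)\<^sup>2 * N t" by (intro mult_left_mono first) simp
    finally show ?thesis using 1 2 by (simp add: C_def algebra_simps)
  qed
  have mono: "exp (C * t) * N t \<le> exp (C * T) * N T" if "0 < t" "t \<le> T" for t
  proof (rule DERIV_nonneg_imp_nondecreasing[OF that(2)])
    fix x assume "t \<le> x" "x \<le> T"
    then have x: "x > 0" using that by simp
    have "((\<lambda>t. exp (C * t) * N t) has_real_derivative exp (C * x) * (C * N x + N' x)) (at x)"
      using d[OF x] by (auto intro!: derivative_eq_intros simp: algebra_simps)
    then show "\<exists>y. ((\<lambda>t. exp (C * t) * N t) has_real_derivative y) (at x) \<and> 0 \<le> y"
      using N'[OF x] by (meson exp_ge_zero mult_nonneg_nonneg)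
  qed
  show ?thesis
  proof (rule that)
    fix t assume t: "0 < t" "t \<le> T"
    have "C \<ge> 0" by (simp add: C_def)
    then have "1 \<le> exp (C * t)" using t by simp
    moreover have "N t \<ge> 0" using first[of t] by (meson order_trans zero_le_power2)
    ultimately have "N t \<le> exp (C * t) * N t" using mult_right_mono[of 1 "exp (C * t)" "N t"] by simp
    then have "(norm (f t))\<^sup>2 \<le> exp (C * T) * N T" using first[of t] mono[OF t] by linarith
    then show "norm (f t) \<le> sqrt (exp (C * T) * N T)" by (rule real_le_rsqrt)
  qed
qed

section \<open>Differences of eigenfunctions, their integrability at the origin, and vanishing for
  zero initial values\<close>

lemma RL_eigenfunction_diff:
  assumes "RL_eigenfunction \<alpha> \<mu> f" "RL_eigenfunction \<alpha> \<mu> g"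
  shows "RL_eigenfunction \<alpha> \<mu> (\<lambda>t. f t - g t)"
    and "k \<le> nat \<lceil>\<alpha>\<rceil> \<Longrightarrow> t > 0 \<Longrightarrow>
      nderiv k (RL_integral (real_of_int \<lceil>\<alpha>\<rceil> - \<alpha>) (\<lambda>t. f t - g t)) t
      = nderiv k (RL_integral (real_of_int \<lceil>\<alpha>\<rceil> - \<alpha>) f) t - nderiv k (RL_integral (real_of_int \<lceil>\<alpha>\<rceil> - \<alpha>) g) t"
proof -
  define \<nu> where "\<nu> = real_of_int \<lceil>\<alpha>\<rceil> - \<alpha>"
  define m where "m = nat \<lceil>\<alpha>\<rceil>"
  have f: "smooth_on f {0<..}" "\<And>t. t > 0 \<Longrightarrow> RL_integral_converges \<nu> f t"
    "ndifferentiable_on m (RL_integral \<nu> f) {0<..}" "\<And>t. t > 0 \<Longrightarrow> nderiv m (RL_integral \<nu> f) t = \<mu> * f t"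
    and g: "smooth_on g {0<..}" "\<And>t. t > 0 \<Longrightarrow> RL_integral_converges \<nu> g t"
    "ndifferentiable_on m (RL_integral \<nu> g) {0<..}" "\<And>t. t > 0 \<Longrightarrow> nderiv m (RL_integral \<nu> g) t = \<mu> * g t"
    using assms unfolding RL_eigenfunction_def RL_deriv_def \<nu>_def m_def by auto
  note D = nderiv_eqI[of "{0<..}" "RL_integral \<nu> (\<lambda>t. f t - g t)"
      "\<lambda>k t. nderiv k (RL_integral \<nu> f) t - nderiv k (RL_integral \<nu> g) t" m]
  have D1: "ndifferentiable_on m (RL_integral \<nu> (\<lambda>t. f t - g t)) {0<..}"
    using f g by (intro D(1)) (auto simp: RL_integral_diff
        intro!: has_vector_derivative_diff ndifferentiable_on_has_vector_derivative)
  have D2: "nderiv k (RL_integral \<nu> (\<lambda>t. f t - g t)) t = nderiv k (RL_integral \<nu> f) t - nderiv k (RL_integral \<nu> g) t"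
    if "k \<le> m" "t > 0" for k t
    using f g that by (intro D(2)) (auto simp: RL_integral_diff
        intro!: has_vector_derivative_diff ndifferentiable_on_has_vector_derivative)
  show "k \<le> nat \<lceil>\<alpha>\<rceil> \<Longrightarrow> t > 0 \<Longrightarrow>
      nderiv k (RL_integral (real_of_int \<lceil>\<alpha>\<rceil> - \<alpha>) (\<lambda>t. f t - g t)) t
      = nderiv k (RL_integral (real_of_int \<lceil>\<alpha>\<rceil> - \<alpha>) f) t - nderiv k (RL_integral (real_of_int \<lceil>\<alpha>\<rceil> - \<alpha>) g) t"
    using D2 by (simp add: m_def \<nu>_def)
  have "smooth_on (\<lambda>t. f t - g t) {0<..}"
    using f(1) g(1) nderiv_diff(1)[of "{0<..}"] by (simp add: smooth_on_def)
  then show "RL_eigenfunction \<alpha> \<mu> (\<lambda>t. f t - g t)"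
    using D1 D2[of m] f g unfolding RL_eigenfunction_def RL_deriv_def \<nu>_def[symmetric] m_def[symmetric]
    by (auto simp: RL_integral_diff algebra_simps)
qed

lemma Caputo_eigenfunction_diff:
  assumes "Caputo_eigenfunction \<alpha> \<mu> f" "Caputo_eigenfunction \<alpha> \<mu> g"
  shows "Caputo_eigenfunction \<alpha> \<mu> (\<lambda>t. f t - g t)"
    and "t > 0 \<Longrightarrow> nderiv k (\<lambda>t. f t - g t) t = nderiv k f t - nderiv k g t"
proof -
  define \<nu> where "\<nu> = real_of_int \<lceil>\<alpha>\<rceil> - \<alpha>"
  define m where "m = nat \<lceil>\<alpha>\<rceil>"
  have f: "smooth_on f {0<..}" "\<And>t. t > 0 \<Longrightarrow> RL_integral_converges \<nu> (nderiv m f) t"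
    "\<And>t. t > 0 \<Longrightarrow> RL_integral \<nu> (nderiv m f) t = \<mu> * f t"
    and g: "smooth_on g {0<..}" "\<And>t. t > 0 \<Longrightarrow> RL_integral_converges \<nu> (nderiv m g) t"
    "\<And>t. t > 0 \<Longrightarrow> RL_integral \<nu> (nderiv m g) t = \<mu> * g t"
    using assms unfolding Caputo_eigenfunction_def Caputo_deriv_def \<nu>_def m_def by auto
  have D: "nderiv k (\<lambda>t. f t - g t) t = nderiv k f t - nderiv k g t" if "t > 0" for k t
    using f(1) g(1) nderiv_diff(2)[of "{0<..}" k f g k t] that by (simp add: smooth_on_def)
  then show "t > 0 \<Longrightarrow> nderiv k (\<lambda>t. f t - g t) t = nderiv k f t - nderiv k g t" .
  have "smooth_on (\<lambda>t. f t - g t) {0<..}"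
    using f(1) g(1) nderiv_diff(1)[of "{0<..}"] by (simp add: smooth_on_def)
  moreover have "RL_integral_converges \<nu> (nderiv m (\<lambda>t. f t - g t)) t
      \<and> RL_integral \<nu> (nderiv m (\<lambda>t. f t - g t)) t = \<mu> * (f t - g t)" if t: "t > 0" for t
    using RL_integral_cong[OF t, of "nderiv m (\<lambda>t. f t - g t)" "\<lambda>t. nderiv m f t - nderiv m g t" \<nu>] D
      RL_integral_diff[OF f(2) g(2), OF t t] f(3)[OF t] g(3)[OF t]
    by (simp add: algebra_simps)
  ultimately show "Caputo_eigenfunction \<alpha> \<mu> (\<lambda>t. f t - g t)"
    unfolding Caputo_eigenfunction_def Caputo_deriv_def \<nu>_def[symmetric] m_def[symmetric] by auto
qed

text \<open>For non-integer \<open>\<alpha>\<close> this follows from the convergence of the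
  fractional integral; for integer \<open>\<alpha>\<close> the equation is an ordinary differential
  equation and its solutions are bounded near 0.\<close>

lemma RL_eigenfunction_set_integrable:
  assumes \<alpha>: "\<alpha> > 0" and h: "RL_eigenfunction \<alpha> \<mu> h" and t: "t > 0"
  shows "set_integrable lborel {0<..<t} h"
proof -
  define \<nu> where "\<nu> = real_of_int \<lceil>\<alpha>\<rceil> - \<alpha>"
  define m where "m = nat \<lceil>\<alpha>\<rceil>"
  have m: "m > 0" using \<alpha> by (auto simp: m_def)
  have \<nu>: "0 \<le> \<nu>" "\<nu> < 1" unfolding \<nu>_def by linarith+
  have sm: "smooth_on h {0<..}" and conv: "RL_integral_converges \<nu> h t"
    and du: "ndifferentiable_on m (RL_integral \<nu> h) {0<..}"
    and eq: "\<And>t. t > 0 \<Longrightarrow> nderiv m (RL_integral \<nu> h) t = \<mu> * h t"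
    using h t unfolding RL_eigenfunction_def RL_deriv_def \<nu>_def m_def by auto
  have ch: "continuous_on {0<..} h"
    using ndifferentiable_on_continuous_on[of 1 h _ 0] sm by (simp add: smooth_on_def)
  show ?thesis
  proof (cases "\<nu> = 0")
    case True
    obtain B where "\<And>z. 0 < z \<Longrightarrow> z \<le> t \<Longrightarrow> norm (h z) \<le> B"
      using ODE_eigenfunction_bounded[OF m, of h \<mu> t] du eq by (auto simp: True)
    then show ?thesis using set_integrable_bounded_continuous[OF ch] by (metis less_imp_le)
  next
    case False
    then show ?thesis using set_integrable_of_RL_integral_converges[OF _ _ ch conv] \<nu> by simp
  qed
qed

text \<open>The same two cases, with the fractional integral now acting on the top derivative; for
  integer \<open>\<alpha>\<close> that derivative is \<open>\<mu> * h\<close>, with \<open>h\<close>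
  bounded near 0.\<close>

lemma Caputo_eigenfunction_set_integrable:
  assumes \<alpha>: "\<alpha> > 0" and h: "Caputo_eigenfunction \<alpha> \<mu> h" and t: "t > 0"
  shows "set_integrable lborel {0<..<t} (nderiv (nat \<lceil>\<alpha>\<rceil>) h)"
proof -
  define \<nu> where "\<nu> = real_of_int \<lceil>\<alpha>\<rceil> - \<alpha>"
  define m where "m = nat \<lceil>\<alpha>\<rceil>"
  have m: "m > 0" using \<alpha> by (auto simp: m_def)
  have \<nu>: "0 \<le> \<nu>" "\<nu> < 1" unfolding \<nu>_def by linarith+
  have sm: "smooth_on h {0<..}" and conv: "RL_integral_converges \<nu> (nderiv m h) t"
    and eq: "\<And>t. t > 0 \<Longrightarrow> RL_integral \<nu> (nderiv m h) t = \<mu> * h t"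
    using h t unfolding Caputo_eigenfunction_def Caputo_deriv_def \<nu>_def m_def by auto
  have cont: "continuous_on {0<..} (nderiv k h)" for k
    using ndifferentiable_on_continuous_on[of "Suc k" h _ k] sm by (simp add: smooth_on_def)
  have "set_integrable lborel {0<..<t} (nderiv m h)"
  proof (cases "\<nu> = 0")
    case True
    then have eq0: "nderiv m h t = \<mu> * h t" if "t > 0" for t using eq[OF that] by simp
    then obtain B where B: "\<And>z. 0 < z \<Longrightarrow> z \<le> t \<Longrightarrow> norm (h z) \<le> B"
      using ODE_eigenfunction_bounded[OF m, of h \<mu> t] sm by (auto simp: smooth_on_def)
    then show ?thesis
      by (intro set_integrable_bounded_continuous[OF cont, where B = "norm \<mu> * B"])
        (simp add: eq0 norm_mult mult_left_mono)
  next
    case False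
    then show ?thesis using set_integrable_of_RL_integral_converges[OF _ _ cont conv] \<nu> by simp
  qed
  then show ?thesis by (simp add: m_def)
qed

text \<open>On the positive axis the derivative equals \<open>\<mu> * h\<close>, so the regularity
  of \<open>h\<close> passes to it in the form that the results on initial values require.\<close>

lemma
  assumes \<alpha>: "\<alpha> > 0" and h: "RL_eigenfunction \<alpha> \<mu> h"
  shows RL_eigenfunction_continuous_on: "continuous_on {0<..} h"
    and RL_deriv_continuous_on: "continuous_on {0<..} (RL_deriv \<alpha> h)"
    and RL_deriv_set_integrable: "t > 0 \<Longrightarrow> set_integrable lborel {0<..<t} (RL_deriv \<alpha> h)"
proof -
  have eq: "\<And>t. t > 0 \<Longrightarrow> RL_deriv \<alpha> h t = \<mu> * h t" and "smooth_on h {0<..}"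
    using h by (auto simp: RL_eigenfunction_def)
  then show ch: "continuous_on {0<..} h"
    using ndifferentiable_on_continuous_on[of 1 h _ 0] by (simp add: smooth_on_def)
  show "continuous_on {0<..} (RL_deriv \<alpha> h)"
    using continuous_on_mult_left[OF ch, of \<mu>] by (rule continuous_on_eq) (simp add: eq)
  show "set_integrable lborel {0<..<t} (RL_deriv \<alpha> h)" if "t > 0"
  proof -
    have "set_integrable lborel {0<..<t} (\<lambda>z. \<mu> * h z)"
      using RL_eigenfunction_set_integrable[OF \<alpha> h that] by simp
    also have "?this \<longleftrightarrow> ?thesis" by (intro set_integrable_cong) (auto simp: eq)
    finally show ?thesis .
  qed
qed

text \<open>With \<open>u = J\<^sup>\<nu> h\<close>, the vanishing initial values give
  \<open>u = \<mu> J\<^sup>m h\<close>. Applying the integral of order \<open>1 - \<nu>\<close>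
  yields a Volterra equation for \<open>H = J\<^sup>1 h\<close>; then \<open>H = 0\<close>, and
  differentiation gives \<open>h = 0\<close>.\<close>

lemma RL_eigenfunction_eq_zero:
  assumes \<alpha>: "\<alpha> > 0" and h: "RL_eigenfunction \<alpha> \<mu> h"
    and lim: "\<And>k. k < nat \<lceil>\<alpha>\<rceil> \<Longrightarrow>
        (nderiv k (RL_integral (real_of_int \<lceil>\<alpha>\<rceil> - \<alpha>) h) \<longlongrightarrow> 0) (at_right 0)"
    and t: "t > 0"
  shows "h t = 0"
proof -
  define \<nu> where "\<nu> = real_of_int \<lceil>\<alpha>\<rceil> - \<alpha>"
  define m where "m = nat \<lceil>\<alpha>\<rceil>"
  have m: "real m = \<alpha> + \<nu>" "m > 0" using \<alpha> by (auto simp: m_def \<nu>_def)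
  have \<nu>: "0 \<le> \<nu>" "\<nu> < 1" unfolding \<nu>_def by linarith+
  define u where "u = RL_integral \<nu> h"
  have du: "ndifferentiable_on m u {0<..}" and eq: "\<And>t. t > 0 \<Longrightarrow> nderiv m u t = \<mu> * h t"
    using h unfolding RL_eigenfunction_def RL_deriv_def \<nu>_def m_def u_def by auto
  have w: "nderiv m u = RL_deriv \<alpha> h" by (simp add: RL_deriv_def m_def u_def \<nu>_def)
  note ch = RL_eigenfunction_continuous_on[OF \<alpha> h]
    and ih = RL_eigenfunction_set_integrable[OF \<alpha> h]
    and cw = RL_deriv_continuous_on[OF \<alpha> h, folded w]
    and iw = RL_deriv_set_integrable[OF \<alpha> h, folded w]
  have u: "u t = \<mu> * RL_integral (real m) h t" if "t > 0" for t
  proof -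
    have "u t = RL_integral (real m) (nderiv m u) t"
      using lim by (intro eq_RL_integral_nderiv du cw iw that) (auto simp: u_def \<nu>_def m_def)
    also have "\<dots> = RL_integral (real m) (\<lambda>z. \<mu> * h z) t"
      using eq by (intro RL_integral_cong that)
    finally show ?thesis by (simp add: RL_integral_mult_left)
  qed
  \<comment> \<open>Passing to the ordinary integral of \<open>h\<close> replaces the inversion of \<open>J\<^sup>\<nu>\<close> by the semigroup law.\<close>
  define H where "H = RL_integral 1 h"
  have H: "H t = \<mu> * RL_integral \<alpha> H t" if t: "t > 0" for t
  proof -
    \<comment> \<open>The orders add up to exactly 1, the smallest total that the semigroup law
      admits.\<close>
    have "H t = RL_integral (1 - \<nu>) u t"
      unfolding H_def u_def using \<nu> t ih by (subst RL_integral_semigroup) auto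
    also have "\<dots> = RL_integral (1 - \<nu>) (\<lambda>z. \<mu> * RL_integral (real m) h z) t"
      by (intro RL_integral_cong t u)
    also have "\<dots> = \<mu> * RL_integral (1 - \<nu>) (RL_integral (real m) h) t"
      by (rule RL_integral_mult_left)
    also have "RL_integral (1 - \<nu>) (RL_integral (real m) h) t = RL_integral (\<alpha> + 1) h t"
      using \<nu> m t ih \<alpha> by (subst RL_integral_semigroup) (auto simp: add.commute)
    also have "\<dots> = RL_integral \<alpha> H t"
      unfolding H_def using t ih \<alpha> by (subst RL_integral_semigroup) auto
    finally show ?thesis .
  qed
  have dH: "(H has_vector_derivative h t) (at t)" if "t > 0" for t
    unfolding H_def using RL_integral_1_has_vector_derivative[OF ch ih that] .
  have cH: "continuous_on {0<..} H"
    using dH by (auto intro!: continuous_at_imp_continuous_on has_vector_derivative_continuous)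
  have "H t = 0" if "t > 0" for t
  proof -
    obtain M where "\<And>z. 0 < z \<Longrightarrow> z \<le> t \<Longrightarrow> norm (H z) \<le> M"
      using bounded_continuous_tendsto_at_right[OF cH, of 0 t] RL_integral_1_tendsto[OF ch ih]
      unfolding H_def by blast
    then show ?thesis using Volterra_eq_zero[OF \<alpha> _ H that] by blast
  qed
  then have "(H has_vector_derivative 0) (at t)"
    using t by (intro has_vector_derivative_transform_within_open[of "\<lambda>_. 0" 0 t "{0<..}" H]) auto
  then show ?thesis using vector_derivative_unique_at dH t by blast
qed

text \<open>Here \<open>h\<close> is itself among the functions that tend to 0, hence bounded near
  0. Splitting the Taylor formula of order \<open>m = \<alpha> + \<nu>\<close> by the semigroup law
  gives the Volterra equation for \<open>h\<close> directly.\<close>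

lemma Caputo_eigenfunction_eq_zero:
  assumes \<alpha>: "\<alpha> > 0" and h: "Caputo_eigenfunction \<alpha> \<mu> h"
    and lim: "\<And>k. k < nat \<lceil>\<alpha>\<rceil> \<Longrightarrow> (nderiv k h \<longlongrightarrow> 0) (at_right 0)"
    and t: "t > 0"
  shows "h t = 0"
proof -
  define \<nu> where "\<nu> = real_of_int \<lceil>\<alpha>\<rceil> - \<alpha>"
  define m where "m = nat \<lceil>\<alpha>\<rceil>"
  have m: "real m = \<alpha> + \<nu>" "m > 0" using \<alpha> by (auto simp: m_def \<nu>_def)
  have \<nu>: "0 \<le> \<nu>" "\<nu> < 1" unfolding \<nu>_def by linarith+
  have sm: "smooth_on h {0<..}"
    and eq: "\<And>t. t > 0 \<Longrightarrow> RL_integral \<nu> (nderiv m h) t = \<mu> * h t"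
    using h unfolding Caputo_eigenfunction_def Caputo_deriv_def \<nu>_def m_def by auto
  have cont: "continuous_on {0<..} (nderiv k h)" for k
    using ndifferentiable_on_continuous_on[of "Suc k" h _ k] sm by (simp add: smooth_on_def)
  have dh: "ndifferentiable_on m h {0<..}" using sm by (simp add: smooth_on_def)
  have iw: "set_integrable lborel {0<..<t} (nderiv m h)" if "t > 0" for t
    using Caputo_eigenfunction_set_integrable[OF \<alpha> h that] by (simp add: m_def)
  have "h t = \<mu> * RL_integral \<alpha> h t" if "t > 0" for t
  proof -
    have "h t = RL_integral (real m) (nderiv m h) t"
      using lim by (intro eq_RL_integral_nderiv dh cont iw that) (auto simp: m_def)
    also have "\<dots> = RL_integral \<alpha> (RL_integral \<nu> (nderiv m h)) t"
      using \<alpha> \<nu> m that iw by (subst RL_integral_semigroup) auto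
    also have "\<dots> = RL_integral \<alpha> (\<lambda>z. \<mu> * h z) t"
      by (intro RL_integral_cong that eq)
    finally show ?thesis by (simp add: RL_integral_mult_left)
  qed
  moreover obtain M where "\<And>z. 0 < z \<Longrightarrow> z \<le> t \<Longrightarrow> norm (h z) \<le> M"
    using bounded_continuous_tendsto_at_right[OF cont[of 0], of 0 t] lim[of 0] m by (auto simp: m_def)
  ultimately show ?thesis using Volterra_eq_zero[OF \<alpha> _ _ t] by blast
qed

subsection \<open>Eigenfunctions\<close>

text \<open>The expansion is assumed for \<open>t > 0\<close> only, so that it can also be that of a
  fractional integral of a combination.\<close>

lemma
  fixes s :: "'i \<Rightarrow> real"
  assumes \<alpha>: "\<alpha> > 0" and f: "\<And>t. t > 0 \<Longrightarrow> f t = (\<Sum>j\<in>A. c j * P_fun \<alpha> (s j) \<mu> t)"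
  shows sum_P_fun_smooth_on: "smooth_on f {0<..}"
    and nderiv_sum_P_fun: "t > 0 \<Longrightarrow> nderiv k f t = (\<Sum>j\<in>A. c j * P_fun \<alpha> (s j - real k) \<mu> t)"
proof -
  have d: "((\<lambda>t. \<Sum>j\<in>A. c j * P_fun \<alpha> (s j - real k) \<mu> t) has_vector_derivative
      (\<Sum>j\<in>A. c j * P_fun \<alpha> (s j - real (Suc k)) \<mu> t)) (at t)" if "t > 0" for k t
  proof (intro has_vector_derivative_sum has_vector_derivative_mult_right)
    fix j
    show "(P_fun \<alpha> (s j - real k) \<mu> has_vector_derivative P_fun \<alpha> (s j - real (Suc k)) \<mu> t) (at t)"
      using P_fun_has_vector_derivative[OF \<alpha> that, of "s j - real k" \<mu>] by (simp add: algebra_simps)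
  qed
  note D = nderiv_eqI[of "{0<..}" f "\<lambda>k t. \<Sum>j\<in>A. c j * P_fun \<alpha> (s j - real k) \<mu> t"]
  show "smooth_on f {0<..}"
    unfolding smooth_on_def using f d by (intro allI D(1)) auto
  show "t > 0 \<Longrightarrow> nderiv k f t = (\<Sum>j\<in>A. c j * P_fun \<alpha> (s j - real k) \<mu> t)"
    using f d by (intro D(2)[where n = k]) auto
qed

lemma RL_integral_sum_P_fun:
  fixes s :: "'i \<Rightarrow> real"
  assumes \<alpha>: "\<alpha> > 0" and f: "\<And>t. t > 0 \<Longrightarrow> f t = (\<Sum>j\<in>A. c j * P_fun \<alpha> (s j) \<mu> t)"
    and A: "finite A" and s: "\<And>j. j \<in> A \<Longrightarrow> s j > -1" and \<nu>: "\<nu> \<ge> 0" and t: "t > 0"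
  shows "RL_integral_converges \<nu> f t"
    and "RL_integral \<nu> f t = (\<Sum>j\<in>A. c j * P_fun \<alpha> (s j + \<nu>) \<mu> t)"
  using RL_integral_sum[where A = A and f = "\<lambda>j. P_fun \<alpha> (s j) \<mu>" and t = t and c = c and \<nu> = \<nu>] RL_integral_P_fun[OF \<alpha> s \<nu> t] A
    RL_integral_cong[OF t f, where \<nu> = \<nu>]
  by auto

text \<open>For \<open>i < j\<close> the prefactor has a negative power, but the leading coefficient
  vanishes, and \<open>P_fun_shift\<close> turns the exponent into
  \<open>i - j + \<alpha>\<close>.\<close>

lemma P_fun_int_tendsto:
  assumes \<alpha>: "\<alpha> > 0" and i: "i < nat \<lceil>\<alpha>\<rceil>" and j: "j < nat \<lceil>\<alpha>\<rceil>"
  shows "(P_fun \<alpha> (real i - real j) \<mu> \<longlongrightarrow> (if j = i then 1 else 0)) (at_right 0)"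
proof (cases "i < j")
  case False
  then show ?thesis using P_fun_tendsto[OF \<alpha>, of "real i - real j" \<mu>] by (auto split: if_splits)
next
  case True
  \<comment> \<open>An integer below the ceiling of \<open>\<alpha>\<close> is strictly below
    \<open>\<alpha>\<close>, so the shifted exponent is positive.\<close>
  have "real j < \<alpha>" using j by linarith
  then have pos: "real i - real j + \<alpha> > 0" by simp
  have "real i - real j + 1 = - of_nat (j - i - 1)" using True by (simp add: of_nat_diff)
  then have np: "real i - real j + 1 \<in> \<int>\<^sub>\<le>\<^sub>0" by (simp only: minus_of_nat_in_nonpos_Ints)
  have "((\<lambda>t. \<mu> * P_fun \<alpha> (real i - real j + \<alpha>) \<mu> t) \<longlongrightarrow> \<mu> * 0) (at_right 0)"
    using P_fun_tendsto[OF \<alpha>, of "real i - real j + \<alpha>" \<mu>] pos by (intro tendsto_mult_left) auto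
  moreover have "\<forall>\<^sub>F t in at_right 0. \<mu> * P_fun \<alpha> (real i - real j + \<alpha>) \<mu> t = P_fun \<alpha> (real i - real j) \<mu> t"
    using P_fun_shift[OF \<alpha> _ np] by (auto simp: eventually_at_filter)
  ultimately show ?thesis using True Lim_transform_eventually by fastforce
qed

lemma sum_tendsto_at_right_coeff:
  fixes g :: "real \<Rightarrow> complex" and i n :: nat
  assumes i: "i < n" and G: "\<And>j. j < n \<Longrightarrow> (G j \<longlongrightarrow> (if j = i then 1 else 0)) (at_right 0)"
    and g: "\<And>t. t > 0 \<Longrightarrow> g t = (\<Sum>j<n. c j * G j t)"
  shows "(g \<longlongrightarrow> c i) (at_right 0)"
proof -
  have "((\<lambda>t. \<Sum>j<n. c j * G j t) \<longlongrightarrow> (\<Sum>j<n. c j * (if j = i then 1 else 0))) (at_right 0)"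
    by (intro tendsto_sum tendsto_mult_left G) auto
  also have "(\<Sum>j<n. c j * (if j = i then 1 else 0)) = c i"
    using i by (simp add: if_distrib cong: if_cong)
  finally show ?thesis
    by (rule Lim_transform_eventually) (use g in \<open>auto simp: eventually_at_filter\<close>)
qed

text \<open>The fractional integral lifts the exponent \<open>\<alpha> - j - 1\<close> to the
  integer \<open>m - j - 1\<close>. After \<open>m\<close> derivatives it is \<open>- j - 1\<close>,
  where \<open>P_fun_shift\<close> returns \<open>\<mu>\<close> times the original function; after
  \<open>m - 1 - i\<close> derivatives it is \<open>i - j\<close>, whose limits are Kronecker
  deltas.\<close>

lemma
  assumes \<alpha>: "\<alpha> > 0" and f: "\<And>t. t > 0 \<Longrightarrow> f t = (\<Sum>j<nat \<lceil>\<alpha>\<rceil>. c j * R_fun \<alpha> (real j) \<mu> t)"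
  shows RL_eigenfunction_sum_R_fun: "RL_eigenfunction \<alpha> \<mu> f"
    and sum_R_fun_tendsto: "i < nat \<lceil>\<alpha>\<rceil> \<Longrightarrow>
      (nderiv (nat \<lceil>\<alpha>\<rceil> - Suc i) (RL_integral (real_of_int \<lceil>\<alpha>\<rceil> - \<alpha>) f) \<longlongrightarrow> c i) (at_right 0)"
proof -
  define \<nu> where "\<nu> = real_of_int \<lceil>\<alpha>\<rceil> - \<alpha>"
  define m where "m = nat \<lceil>\<alpha>\<rceil>"
  have m: "real m = \<alpha> + \<nu>" using \<alpha> by (auto simp: m_def \<nu>_def)
  have \<nu>: "0 \<le> \<nu>" "\<nu> < 1" unfolding \<nu>_def by linarith+
  define s where "s = (\<lambda>j. \<alpha> - real j - 1)"
  have fP: "f t = (\<Sum>j<m. c j * P_fun \<alpha> (s j) \<mu> t)" if "t > 0" for t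
    using f[OF that] by (simp add: R_fun_conv_P_fun m_def s_def)
  have s: "s j > -1" if "j \<in> {..<m}" for j
  proof -
    have "real j + 1 \<le> real m" using that by simp
    then show ?thesis using m \<nu> by (simp add: s_def)
  qed
  note I = RL_integral_sum_P_fun[OF \<alpha> fP finite_lessThan s \<nu>(1)]
  have nd: "nderiv k (RL_integral \<nu> f) t = (\<Sum>j<m. c j * P_fun \<alpha> (s j + \<nu> - real k) \<mu> t)" if "t > 0" for k t
    by (rule nderiv_sum_P_fun[OF \<alpha> I(2) that])
  have "nderiv m (RL_integral \<nu> f) t = \<mu> * f t" if t: "t > 0" for t
  proof -
    have "P_fun \<alpha> (s j + \<nu> - real m) \<mu> t = \<mu> * P_fun \<alpha> (s j) \<mu> t" for j
    proof -
      have "s j + \<nu> - real m + 1 = - of_nat j" using m by (simp add: s_def)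
      then have "s j + \<nu> - real m + 1 \<in> \<int>\<^sub>\<le>\<^sub>0" by (simp only: minus_of_nat_in_nonpos_Ints)
      from P_fun_shift[OF \<alpha> t this, of \<mu>] show ?thesis using m by simp
    qed
    then show ?thesis using nd[OF t] fP[OF t] by (simp add: sum_distrib_left mult.left_commute)
  qed
  moreover have "ndifferentiable_on m (RL_integral \<nu> f) {0<..}"
    using sum_P_fun_smooth_on[OF \<alpha> I(2)] by (simp add: smooth_on_def)
  ultimately show "RL_eigenfunction \<alpha> \<mu> f"
    unfolding RL_eigenfunction_def RL_deriv_def \<nu>_def[symmetric] m_def[symmetric]
    using sum_P_fun_smooth_on[OF \<alpha> fP] I(1) by auto
  show "(nderiv (nat \<lceil>\<alpha>\<rceil> - Suc i) (RL_integral (real_of_int \<lceil>\<alpha>\<rceil> - \<alpha>) f) \<longlongrightarrow> c i) (at_right 0)"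
    if i: "i < nat \<lceil>\<alpha>\<rceil>"
  proof (rule sum_tendsto_at_right_coeff[OF i P_fun_int_tendsto[OF \<alpha> i]])
    fix t :: real assume t: "t > 0"
    have "s j + \<nu> - real (m - Suc i) = real i - real j" for j
      using m i by (simp add: s_def m_def of_nat_diff)
    then show "nderiv (nat \<lceil>\<alpha>\<rceil> - Suc i) (RL_integral (real_of_int \<lceil>\<alpha>\<rceil> - \<alpha>) f) t
      = (\<Sum>j<nat \<lceil>\<alpha>\<rceil>. c j * P_fun \<alpha> (real i - real j) \<mu> t)"
      using nd[OF t, of "m - Suc i"] by (simp add: \<nu>_def m_def)
  qed
qed

text \<open>Differentiating \<open>m\<close> times sends the exponent \<open>j\<close> to the
  negative integer \<open>j - m\<close>; \<open>P_fun_shift\<close> turns this into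
  \<open>\<mu>\<close> times the function with exponent \<open>j - \<nu>\<close>, and the integral
  of order \<open>\<nu>\<close> restores \<open>j\<close>.\<close>

lemma
  assumes \<alpha>: "\<alpha> > 0" and f: "\<And>t. t > 0 \<Longrightarrow> f t = (\<Sum>j<nat \<lceil>\<alpha>\<rceil>. c j * P_fun \<alpha> (real j) \<mu> t)"
  shows Caputo_eigenfunction_sum_P_fun: "Caputo_eigenfunction \<alpha> \<mu> f"
    and sum_P_fun_nderiv_tendsto: "i < nat \<lceil>\<alpha>\<rceil> \<Longrightarrow> (nderiv i f \<longlongrightarrow> c i) (at_right 0)"
proof -
  define \<nu> where "\<nu> = real_of_int \<lceil>\<alpha>\<rceil> - \<alpha>"
  define m where "m = nat \<lceil>\<alpha>\<rceil>"
  have m: "real m = \<alpha> + \<nu>" using \<alpha> by (auto simp: m_def \<nu>_def)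
  have \<nu>: "0 \<le> \<nu>" "\<nu> < 1" unfolding \<nu>_def by linarith+
  have fP: "f t = (\<Sum>j<m. c j * P_fun \<alpha> (real j) \<mu> t)" if "t > 0" for t
    using f[OF that] by (simp add: m_def)
  have nd: "nderiv k f t = (\<Sum>j<m. c j * P_fun \<alpha> (real j - real k) \<mu> t)" if "t > 0" for k t
    by (rule nderiv_sum_P_fun[OF \<alpha> fP that])
  have ndm: "nderiv m f t = (\<Sum>j<m. (\<mu> * c j) * P_fun \<alpha> (real j - \<nu>) \<mu> t)" if t: "t > 0" for t
  proof -
    have "P_fun \<alpha> (real j - real m) \<mu> t = \<mu> * P_fun \<alpha> (real j - \<nu>) \<mu> t" if "j < m" for j
    proof -
      have "real j - real m + 1 = - of_nat (m - j - 1)" using that by (simp add: of_nat_diff)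
      then have "real j - real m + 1 \<in> \<int>\<^sub>\<le>\<^sub>0" by (simp only: minus_of_nat_in_nonpos_Ints)
      from P_fun_shift[OF \<alpha> t this, of \<mu>] show ?thesis using m by simp
    qed
    then show ?thesis using nd[OF t, of m] by (simp add: mult_ac)
  qed
  have s: "real j - \<nu> > -1" for j :: nat using \<nu> by (simp add: algebra_simps add_strict_increasing2)
  note I = RL_integral_sum_P_fun[OF \<alpha> ndm finite_lessThan s \<nu>(1)]
  have "RL_integral \<nu> (nderiv m f) t = \<mu> * f t" if t: "t > 0" for t
    using I(2)[OF _ t] fP[OF t] by (simp add: sum_distrib_left mult.assoc)
  then show "Caputo_eigenfunction \<alpha> \<mu> f"
    unfolding Caputo_eigenfunction_def Caputo_deriv_def \<nu>_def[symmetric] m_def[symmetric]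
    using sum_P_fun_smooth_on[OF \<alpha> fP] I(1) by auto
  show "(nderiv i f \<longlongrightarrow> c i) (at_right 0)" if i: "i < nat \<lceil>\<alpha>\<rceil>"
  proof (rule sum_tendsto_at_right_coeff[OF i])
    show "(P_fun \<alpha> (real j - real i) \<mu> \<longlongrightarrow> (if j = i then 1 else 0)) (at_right 0)"
      if "j < nat \<lceil>\<alpha>\<rceil>" for j
      using P_fun_int_tendsto[OF \<alpha> that i, of \<mu>] by (cases "j = i") auto
  qed (use nd in \<open>simp add: m_def\<close>)
qed

text \<open>Lowering the order by an integer leaves the order of the inner fractional integral
  unchanged and only removes outer derivatives; none remain for the largest
  \<open>j\<close>.\<close>

lemma RL_deriv_order_shift:
  assumes "\<alpha> > 0" "j < nat \<lceil>\<alpha>\<rceil>"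
  shows "RL_deriv (\<alpha> - real j - 1) f
    = nderiv (nat \<lceil>\<alpha>\<rceil> - Suc j) (RL_integral (real_of_int \<lceil>\<alpha>\<rceil> - \<alpha>) f)"
proof -
  have c: "\<lceil>\<alpha> - real j - 1\<rceil> = \<lceil>\<alpha>\<rceil> - int j - 1"
    using ceiling_diff_of_int[of \<alpha> "int j + 1"] by (simp add: algebra_simps)
  have "nat (\<lceil>\<alpha>\<rceil> - int j - 1) = nat \<lceil>\<alpha>\<rceil> - Suc j" by linarith
  then show ?thesis unfolding RL_deriv_def c by simp
qed

text \<open>The last two conjuncts recover the coefficients as limits at 0, so \<open>f\<close>
  determines them. In the Riemann-Liouville case the limits are those of derivatives of order
  \<open>\<alpha> - j - 1\<close>, since \<open>f\<close> itself may be unbounded at 0.\<close>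

theorem theorem2p10:
  fixes \<alpha> :: real and \<mu> :: complex and f :: "real \<Rightarrow> complex"
  assumes "\<alpha> > 0"
  shows "(RL_eigenfunction \<alpha> \<mu> f \<longleftrightarrow>
           (\<exists>c :: nat \<Rightarrow> complex. \<forall>t>0. f t = (\<Sum>j<nat \<lceil>\<alpha>\<rceil>. c j * R_fun \<alpha> (real j) \<mu> t)))
       \<and> (Caputo_eigenfunction \<alpha> \<mu> f \<longleftrightarrow>
           (\<exists>c :: nat \<Rightarrow> complex. \<forall>t>0. f t = (\<Sum>j<nat \<lceil>\<alpha>\<rceil>. c j * P_fun \<alpha> (real j) \<mu> t)))
       \<and> (\<forall>c :: nat \<Rightarrow> complex.
           (\<forall>t>0. f t = (\<Sum>j<nat \<lceil>\<alpha>\<rceil>. c j * R_fun \<alpha> (real j) \<mu> t)) \<longrightarrow>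
           (\<forall>j<nat \<lceil>\<alpha>\<rceil>. (RL_deriv (\<alpha> - real j - 1) f \<longlongrightarrow> c j) (at_right 0)))
       \<and> (\<forall>c :: nat \<Rightarrow> complex.
           (\<forall>t>0. f t = (\<Sum>j<nat \<lceil>\<alpha>\<rceil>. c j * P_fun \<alpha> (real j) \<mu> t)) \<longrightarrow>
           (\<forall>j<nat \<lceil>\<alpha>\<rceil>. (nderiv j f \<longlongrightarrow> c j) (at_right 0)))"
proof (intro conjI allI impI iffI)
  note \<alpha> = assms
  define \<nu> where "\<nu> = real_of_int \<lceil>\<alpha>\<rceil> - \<alpha>"
  define m where "m = nat \<lceil>\<alpha>\<rceil>"
  {
    assume f: "RL_eigenfunction \<alpha> \<mu> f"
    have w: "nderiv m (RL_integral \<nu> f) = RL_deriv \<alpha> f"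
      by (simp add: RL_deriv_def m_def \<nu>_def)
    have du: "ndifferentiable_on m (RL_integral \<nu> f) {0<..}"
      using f by (simp add: RL_eigenfunction_def m_def \<nu>_def)
    have "\<exists>b. (nderiv (m - Suc j) (RL_integral \<nu> f) \<longlongrightarrow> b) (at_right 0)" if "j < m" for j
      using nderiv_tendsto_ex[OF du, unfolded w, OF RL_deriv_continuous_on[OF \<alpha> f]
          RL_deriv_set_integrable[OF \<alpha> f], of "m - Suc j"] that by simp
    then obtain c where c: "\<And>j. j < m \<Longrightarrow> (nderiv (m - Suc j) (RL_integral \<nu> f) \<longlongrightarrow> c j) (at_right 0)"
      by metis
    define g where "g = (\<lambda>t. \<Sum>j<nat \<lceil>\<alpha>\<rceil>. c j * R_fun \<alpha> (real j) \<mu> t)"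
    have g: "RL_eigenfunction \<alpha> \<mu> g"
      by (rule RL_eigenfunction_sum_R_fun[OF \<alpha>]) (simp add: g_def)
    have cg: "(nderiv (m - Suc j) (RL_integral \<nu> g) \<longlongrightarrow> c j) (at_right 0)" if "j < m" for j
      unfolding m_def \<nu>_def by (rule sum_R_fun_tendsto[OF \<alpha>]) (use that in \<open>auto simp: g_def m_def\<close>)
    have lim: "(nderiv k (RL_integral \<nu> (\<lambda>t. f t - g t)) \<longlongrightarrow> 0) (at_right 0)" if k: "k < m" for k
    proof -
      \<comment> \<open>The coefficients are numbered from the highest derivative downwards, so
        order \<open>k\<close> corresponds to the index \<open>m - Suc k\<close>.\<close>
      have "k = m - Suc (m - Suc k)" "m - Suc k < m" using k by auto
      then have "((\<lambda>t. nderiv k (RL_integral \<nu> f) t - nderiv k (RL_integral \<nu> g) t) \<longlongrightarrow> 0) (at_right 0)"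
        using tendsto_diff[OF c[of "m - Suc k"] cg[of "m - Suc k"]] by simp
      moreover have "\<forall>\<^sub>F t in at_right 0. nderiv k (RL_integral \<nu> f) t - nderiv k (RL_integral \<nu> g) t
          = nderiv k (RL_integral \<nu> (\<lambda>t. f t - g t)) t"
        using RL_eigenfunction_diff(2)[OF f g, of k] k by (auto simp: eventually_at_filter m_def \<nu>_def)
      ultimately show ?thesis by (rule Lim_transform_eventually)
    qed
    have "f t - g t = 0" if "t > 0" for t
      using RL_eigenfunction_eq_zero[OF \<alpha> RL_eigenfunction_diff(1)[OF f g] _ that] lim
      by (simp add: m_def \<nu>_def)
    then show "\<exists>c. \<forall>t>0. f t = (\<Sum>j<nat \<lceil>\<alpha>\<rceil>. c j * R_fun \<alpha> (real j) \<mu> t)"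
      by (intro exI[of _ c]) (simp add: g_def)
  }
  {
    assume f: "Caputo_eigenfunction \<alpha> \<mu> f"
    have sm: "ndifferentiable_on n f {0<..}" for n
      using f by (simp add: Caputo_eigenfunction_def smooth_on_def)
    have "\<exists>b. (nderiv j f \<longlongrightarrow> b) (at_right 0)" if "j < m" for j
      \<comment> \<open>Continuity of the derivative of order \<open>m\<close> comes from
        smoothness, through differentiability one order higher.\<close>
      using nderiv_tendsto_ex[OF sm ndifferentiable_on_continuous_on[OF sm lessI]
          Caputo_eigenfunction_set_integrable[OF \<alpha> f]] that by (simp add: m_def)
    then obtain c where c: "\<And>j. j < m \<Longrightarrow> (nderiv j f \<longlongrightarrow> c j) (at_right 0)"
      by metis
    define g where "g = (\<lambda>t. \<Sum>j<nat \<lceil>\<alpha>\<rceil>. c j * P_fun \<alpha> (real j) \<mu> t)"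
    have g: "Caputo_eigenfunction \<alpha> \<mu> g"
      by (rule Caputo_eigenfunction_sum_P_fun[OF \<alpha>]) (simp add: g_def)
    have cg: "(nderiv j g \<longlongrightarrow> c j) (at_right 0)" if "j < m" for j
      by (rule sum_P_fun_nderiv_tendsto[OF \<alpha>]) (use that in \<open>auto simp: g_def m_def\<close>)
    have lim: "(nderiv k (\<lambda>t. f t - g t) \<longlongrightarrow> 0) (at_right 0)" if k: "k < m" for k
    proof -
      have "((\<lambda>t. nderiv k f t - nderiv k g t) \<longlongrightarrow> 0) (at_right 0)"
        using tendsto_diff[OF c cg, OF k k] by simp
      moreover have "\<forall>\<^sub>F t in at_right 0. nderiv k f t - nderiv k g t = nderiv k (\<lambda>t. f t - g t) t"
        using Caputo_eigenfunction_diff(2)[OF f g, of _ k] by (auto simp: eventually_at_filter)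
      ultimately show ?thesis by (rule Lim_transform_eventually)
    qed
    have "f t - g t = 0" if "t > 0" for t
      using Caputo_eigenfunction_eq_zero[OF \<alpha> Caputo_eigenfunction_diff(1)[OF f g] _ that] lim
      by (simp add: m_def)
    then show "\<exists>c. \<forall>t>0. f t = (\<Sum>j<nat \<lceil>\<alpha>\<rceil>. c j * P_fun \<alpha> (real j) \<mu> t)"
      by (intro exI[of _ c]) (simp add: g_def)
  }
  show "RL_eigenfunction \<alpha> \<mu> f"
    if "\<exists>c. \<forall>t>0. f t = (\<Sum>j<nat \<lceil>\<alpha>\<rceil>. c j * R_fun \<alpha> (real j) \<mu> t)"
    using that RL_eigenfunction_sum_R_fun[OF \<alpha>] by blast
  show "Caputo_eigenfunction \<alpha> \<mu> f"
    if "\<exists>c. \<forall>t>0. f t = (\<Sum>j<nat \<lceil>\<alpha>\<rceil>. c j * P_fun \<alpha> (real j) \<mu> t)"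
    using that Caputo_eigenfunction_sum_P_fun[OF \<alpha>] by blast
  fix c j assume j: "j < nat \<lceil>\<alpha>\<rceil>"
  show "(RL_deriv (\<alpha> - real j - 1) f \<longlongrightarrow> c j) (at_right 0)"
    if "\<forall>t>0. f t = (\<Sum>j<nat \<lceil>\<alpha>\<rceil>. c j * R_fun \<alpha> (real j) \<mu> t)"
    unfolding RL_deriv_order_shift[OF \<alpha> j] by (rule sum_R_fun_tendsto[OF \<alpha> _ j]) (use that in blast)
  show "(nderiv j f \<longlongrightarrow> c j) (at_right 0)"
    if "\<forall>t>0. f t = (\<Sum>j<nat \<lceil>\<alpha>\<rceil>. c j * P_fun \<alpha> (real j) \<mu> t)"
    by (rule sum_P_fun_nderiv_tendsto[OF \<alpha> _ j]) (use that in blast)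
qed

end
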